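(* Let $k\ge 1$ be an integer and let $G$ be a graph. The following statements are equivalent: (1) every connected induced subgraph $H$ of $G$ satisfies $\operatorname{pe}(H)<k$; (2) $G$ is $\{S_k,T_k\}$-free.
   Context: All graphs are finite and simple. For a connected graph $G$ and a path $P$ in $G$, the eccentricity of $P$ is the maximum, over all vertices $v$ of $G$, of the distance from $v$ to the vertex set of $P$. The path eccentricity $\operatorname{pe}(G)$ of a connected graph $G$ is the minimum eccentricity of a path in $G$. $S_k$ (the $k$-subdivided claw) is the graph obtained from $K_{1,3}$ by replacing each edge by a path of length $k$ (length = number of edges). $T_k$ (the $k$-subdivided net) is the graph obtained from the triangle $K_3$ by attaching to each of its three vertices a new pendant path of length $k$ (the three paths pairwise disjoint). For a set $\mathcal F$ of graphs, $G$ is $\mathcal F$-free if no induced subgraph of $G$ is isomorphic to a member of $\mathcal F$. *)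

theory Defs
  imports
    "Graph_Theory.Digraph_Component"
    "Graph_Theory.Digraph_Isomorphism"
    "Graph_Theory.Vertex_Walk"
begin

text \<open>
  Finite simple graphs are the finite, loop-free, symmetric digraphs without parallel arcs,
  that is, the locale predicate \<^const>\<open>graph\<close>; every edge is a pair of opposite arcs.
  The predicate \<^const>\<open>Digraph_Component.connected\<close> excludes the null graph, and a
  \<^const>\<open>vpath\<close> is a nonempty list of distinct, consecutively adjacent vertices (not
  necessarily an induced path).
\<close>

definition graph_dist :: "('a,'b) pre_digraph \<Rightarrow> 'a \<Rightarrow> 'a \<Rightarrow> nat" where
  "graph_dist G u v =
    (LEAST n. \<exists>p. vwalk p G \<and> hd p = u \<and> last p = v \<and> vwalk_length p = n)"

text \<open>
  The following three notions are meant for connected finite graphs only, where all the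
  minima and maxima range over finite nonempty sets.
\<close>

definition dist_to_set :: "('a,'b) pre_digraph \<Rightarrow> 'a \<Rightarrow> 'a set \<Rightarrow> nat" where
  "dist_to_set G v S = Min ((\<lambda>u. graph_dist G v u) ` S)"

definition path_ecc :: "('a,'b) pre_digraph \<Rightarrow> 'a list \<Rightarrow> nat" where
  "path_ecc G p = Max ((\<lambda>v. dist_to_set G v (set p)) ` verts G)"

definition path_eccentricity :: "('a,'b) pre_digraph \<Rightarrow> nat" where
  "path_eccentricity G = Min (path_ecc G ` {p. vpath p G})"

text \<open>
  In both graphs below, \<open>(i, j)\<close> with \<open>i < 3\<close> is the vertex at distance \<open>j\<close> from the start
  of the \<open>i\<close>-th path. In the subdivided claw the three paths all start at the centre, which
  is represented by \<open>(0, 0)\<close> alone; in the subdivided net the starts \<open>(i, 0)\<close> form a triangle.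
\<close>

definition subdivided_claw :: "nat \<Rightarrow> (nat \<times> nat) pair_pre_digraph" where
  "subdivided_claw k =
    \<lparr> pverts = insert (0, 0) ({0..<3} \<times> {1..k}),
      parcs = symcl {(if j = 0 then (0, 0) else (i, j), (i, Suc j)) | i j. i < 3 \<and> j < k} \<rparr>"

definition subdivided_net :: "nat \<Rightarrow> (nat \<times> nat) pair_pre_digraph" where
  "subdivided_net k =
    \<lparr> pverts = {0..<3} \<times> {0..k},
      parcs = symcl ({((i, 0), (i', 0)) | i i'. i < 3 \<and> i' < 3 \<and> i \<noteq> i'}
                   \<union> {((i, j), (i, Suc j)) | i j. i < 3 \<and> j < k}) \<rparr>"

definition induced_free :: "('c,'d) pre_digraph set \<Rightarrow> ('a,'b) pre_digraph \<Rightarrow> bool" where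
  "induced_free \<F> G \<longleftrightarrow>
    \<not> (\<exists>H F. induced_subgraph H G \<and> F \<in> \<F> \<and> digraph_iso H F)"

lemma sym_symcl: "sym (symcl r)"
  by (rule symI) (auto simp: symcl_def image_iff)

lemma graph_subdivided_claw: "graph (with_proj (subdivided_claw k))"
proof -
  have sub: "parcs (subdivided_claw k) \<subseteq> pverts (subdivided_claw k) \<times> pverts (subdivided_claw k)"
    by (auto simp: subdivided_claw_def symcl_def)
  have finV: "finite (pverts (subdivided_claw k))"
    by (simp add: subdivided_claw_def)
  have finA: "finite (parcs (subdivided_claw k))"
    using sub finV by (meson finite_SigmaI finite_subset)
  have sym: "sym (parcs (subdivided_claw k))"
    by (simp add: subdivided_claw_def sym_symcl)
  have irr: "(u, v) \<in> parcs (subdivided_claw k) \<Longrightarrow> u \<noteq> v" for u v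
    by (auto simp: subdivided_claw_def symcl_def split: if_splits)
  have "pair_graph (subdivided_claw k)"
    by unfold_locales (use sub finV finA sym irr in \<open>auto simp: symmetric_def\<close>)
  then show ?thesis
    by (rule pair_graph.pair_graphD_graph)
qed

lemma graph_subdivided_net: "graph (with_proj (subdivided_net k))"
proof -
  have sub: "parcs (subdivided_net k) \<subseteq> pverts (subdivided_net k) \<times> pverts (subdivided_net k)"
    by (auto simp: subdivided_net_def symcl_def)
  have finV: "finite (pverts (subdivided_net k))"
    by (simp add: subdivided_net_def)
  have finA: "finite (parcs (subdivided_net k))"
    using sub finV by (meson finite_SigmaI finite_subset)
  have sym: "sym (parcs (subdivided_net k))"
    by (simp add: subdivided_net_def sym_symcl)
  have irr: "(u, v) \<in> parcs (subdivided_net k) \<Longrightarrow> u \<noteq> v" for u v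
    by (auto simp: subdivided_net_def symcl_def split: if_splits)
  have "pair_graph (subdivided_net k)"
    by unfold_locales (use sub finV finA sym irr in \<open>auto simp: symmetric_def\<close>)
  then show ?thesis
    by (rule pair_graph.pair_graphD_graph)
qed

end

theory Submission
  imports Defs
begin

text \<open>
  If \<open>G\<close> contains an induced subdivided claw or net, a path of that subgraph coming within
  distance \<open>k - 1\<close> of all three leaves meets all three legs, and the leg visited second is entered
  and left through the same vertex.

  Conversely, let \<open>H\<close> be a connected graph without these induced subgraphs, and call a connected
  vertex set a cover if every vertex has distance at most \<open>k - 1\<close> from it. A connected graph without
  induced claw and net is traceable, so it suffices to find a cover without induced claw and net.
  Fix a cover that ends in a pendant path (its tail) and minimise, lexicographically, the numbers of
  its vertices at distance \<open>0, 1, 2, \<dots>\<close> from the root of the tail. A claw or net in such a cover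
  extends to one with long legs: for each of its leaves \<open>a\<close>, the part of the cover cut off by \<open>a\<close>
  either contains the tail, which is the leg, or it cannot be dropped, nor replaced by balls hanging
  off the parts cut off by leaves farther from the root. This gives an uncovered vertex whose ball
  completes the leg and stays away from the other legs.
  A tail of length \<open>k - 1\<close> comes from a cover of minimal size and a vertex that only one non-cut
  vertex of it covers; the cover without its tail then has no claw and no net. If it fails to cover,
  an uncovered vertex farthest along the tail lengthens the tail to at least \<open>k\<close>, and then the whole
  minimal cover has no claw and no net.
\<close>

section \<open>Small index ranges, relation powers and discrete crossings\<close>

lemma all_less_3: "(\<forall>i<3::nat. P i) \<longleftrightarrow> P 0 \<and> P (Suc 0) \<and> P 2"
  by (auto simp: numeral_3_eq_3 less_Suc_eq numeral_2_eq_2)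

lemma lessThan_3: "{..<3::nat} = {0, Suc 0, 2}"
  by (auto simp: numeral_3_eq_3 less_Suc_eq numeral_2_eq_2)

lemma relpowp_sym: "(\<And>x y. P x y \<Longrightarrow> P y x) \<Longrightarrow> (P ^^ n) x y \<Longrightarrow> (P ^^ n) y x"
proof (induction n arbitrary: y)
  case (Suc n)
  from Suc.prems(2) obtain z where z: "(P ^^ n) x z" "P z y" by (rule relpowp_Suc_E)
  show ?case by (rule relpowp_Suc_I2[OF Suc.prems(1)[OF z(2)] Suc.IH[OF Suc.prems(1) z(1)]])
qed simp

lemma crossing_index:
  assumes "m < n" "P m" "\<not> P (n::nat)"
  obtains l where "m \<le> l" "l < n" "P l" "\<not> P (Suc l)"
proof -
  have "P l" if "m \<le> l" "l \<le> n" "\<And>l. m \<le> l \<Longrightarrow> l < n \<Longrightarrow> P l \<Longrightarrow> P (Suc l)" for l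
    using that by (induction l rule: dec_induct) (auto intro: assms)
  then show thesis using that assms by (metis less_imp_le order_refl)
qed

section \<open>Graphs without induced claw and net are traceable\<close>

locale sym_graph =
  fixes adj :: "'a \<Rightarrow> 'a \<Rightarrow> bool"
  assumes adj_commute: "adj x y \<longleftrightarrow> adj y x"
    and adj_irrefl [simp]: "\<not> adj x x"
begin

definition radj :: "'a set \<Rightarrow> 'a \<Rightarrow> 'a \<Rightarrow> bool" where
  "radj D x y \<longleftrightarrow> x \<in> D \<and> y \<in> D \<and> adj x y"

definition conn :: "'a set \<Rightarrow> bool" where
  "conn D \<longleftrightarrow> D \<noteq> {} \<and> (\<forall>x\<in>D. \<forall>y\<in>D. (radj D)\<^sup>*\<^sup>* x y)"

definition comp :: "'a set \<Rightarrow> 'a \<Rightarrow> 'a set" where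
  "comp D x = {y \<in> D. (radj D)\<^sup>*\<^sup>* x y}"

definition traceable :: "'a set \<Rightarrow> bool" where
  "traceable W \<longleftrightarrow> (\<exists>p. distinct p \<and> set p = W \<and> successively adj p)"

text \<open>A claw if \<open>b\<close> is constant on \<open>{..<3}\<close>, a net if \<open>b\<close> is injective there; the leaves are \<open>a i\<close>.\<close>

definition core :: "(nat \<Rightarrow> 'a) \<Rightarrow> (nat \<Rightarrow> 'a) \<Rightarrow> bool" where
  "core b a \<longleftrightarrow> ((\<forall>i<3. b i = b 0) \<or> inj_on b {..<3}) \<and> inj_on a {..<3} \<and>
    (\<forall>i<3. \<forall>j<3. (adj (b i) (b j) \<longleftrightarrow> b i \<noteq> b j) \<and> (adj (b i) (a j) \<longleftrightarrow> b i = b j) \<and>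
      \<not> adj (a i) (a j))"

definition core_free :: "'a set \<Rightarrow> bool" where
  "core_free D \<longleftrightarrow> (\<nexists>b a. core b a \<and> (\<forall>i<3. b i \<in> D \<and> a i \<in> D))"

lemma core_free_mono: "core_free D \<Longrightarrow> E \<subseteq> D \<Longrightarrow> core_free E"
  unfolding core_free_def by blast

lemma no_claw:
  assumes "core_free D" "{c, x, y, z} \<subseteq> D" "adj c x" "adj c y" "adj c z"
    "x \<noteq> y" "x \<noteq> z" "y \<noteq> z"
  shows "adj x y \<or> adj x z \<or> adj y z"
proof (rule ccontr)
  assume neg: "\<not> ?thesis"
  define a where "a = (\<lambda>i::nat. if i = 0 then x else if i = 1 then y else z)"
  have "\<not> adj y x" "\<not> adj z x" "\<not> adj z y"
    using neg by (simp_all add: adj_commute)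
  then have "core (\<lambda>_. c) a"
    using assms(3-8) neg unfolding core_def all_less_3 lessThan_3 a_def by simp
  moreover have "\<forall>i<3. c \<in> D \<and> a i \<in> D"
    using assms unfolding a_def by auto
  ultimately show False
    using assms(1) unfolding core_free_def by blast
qed

lemma no_net:
  assumes "core_free D" "{b0, b1, b2, a0, a1, a2} \<subseteq> D"
    "adj b0 b1" "adj b0 b2" "adj b1 b2" "adj b0 a0" "adj b1 a1" "adj b2 a2"
    "\<not> adj b0 a1" "\<not> adj b0 a2" "\<not> adj b1 a0" "\<not> adj b1 a2" "\<not> adj b2 a0" "\<not> adj b2 a1"
  shows "adj a0 a1 \<or> adj a0 a2 \<or> adj a1 a2"
proof (rule ccontr)
  assume neg: "\<not> ?thesis"
  define a where "a = (\<lambda>i::nat. if i = 0 then a0 else if i = 1 then a1 else a2)"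
  define b where "b = (\<lambda>i::nat. if i = 0 then b0 else if i = 1 then b1 else b2)"
  \<comment> \<open>The adjacency pattern alone separates these vertices: two leaves differ because
    only one of them is adjacent to a given triangle vertex.\<close>
  have "b0 \<noteq> b1" "b0 \<noteq> b2" "b1 \<noteq> b2" "a0 \<noteq> a1" "a0 \<noteq> a2" "a1 \<noteq> a2"
    using assms(3-14) adj_irrefl by metis+
  moreover have "adj b1 b0" "adj b2 b0" "adj b2 b1" "\<not> adj a1 a0" "\<not> adj a2 a0" "\<not> adj a2 a1"
    using assms(3-5) neg by (simp_all add: adj_commute)
  ultimately have "core b a"
    using assms(3-14) neg unfolding core_def all_less_3 lessThan_3 a_def b_def by simp
  moreover have "\<forall>i<3. b i \<in> D \<and> a i \<in> D"
    using assms unfolding a_def b_def by auto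
  ultimately show False
    using assms(1) unfolding core_free_def by blast
qed

section \<open>Connectedness and components inside a vertex set\<close>

lemma radj_sym: "radj D x y \<Longrightarrow> radj D y x"
  by (simp add: radj_def adj_commute)

lemma reach_sym: "(radj D)\<^sup>*\<^sup>* x y \<Longrightarrow> (radj D)\<^sup>*\<^sup>* y x"
  by (induction rule: rtranclp_induct) (auto intro: converse_rtranclp_into_rtranclp radj_sym)

lemma reach_mono: "(radj D)\<^sup>*\<^sup>* x y \<Longrightarrow> D \<subseteq> E \<Longrightarrow> (radj E)\<^sup>*\<^sup>* x y"
  by (erule rtranclp_mono[THEN predicate2D, rotated]) (auto simp: radj_def)

lemma reach_closed:
  "(radj D)\<^sup>*\<^sup>* x y \<Longrightarrow> x \<in> A \<Longrightarrow> (\<And>u v. u \<in> A \<Longrightarrow> radj D u v \<Longrightarrow> v \<in> A) \<Longrightarrow> y \<in> A"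
  by (induction rule: rtranclp_induct) auto

lemma connI:
  assumes "x \<in> D" "\<And>y. y \<in> D \<Longrightarrow> (radj D)\<^sup>*\<^sup>* x y"
  shows "conn D"
  unfolding conn_def using assms by (meson empty_iff reach_sym rtranclp_trans)

lemma connD: "conn D \<Longrightarrow> x \<in> D \<Longrightarrow> y \<in> D \<Longrightarrow> (radj D)\<^sup>*\<^sup>* x y"
  unfolding conn_def by blast

lemma conn_sing [simp]: "conn {x}"
  by (rule connI[of x]) auto

lemma conn_cross:
  assumes "conn D" "x \<in> A" "x \<in> D" "y \<in> D" "y \<notin> A"
  obtains u v where "u \<in> A" "v \<notin> A" "radj D u v"
  using reach_closed[OF connD[OF assms(1,3,4)] assms(2)] assms(5) by blast

lemma conn_Un:
  assumes "conn A" "conn B" "x \<in> A" "y \<in> B" "x = y \<or> adj x y"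
  shows "conn (A \<union> B)"
proof (rule connI[of x])
  fix z assume "z \<in> A \<union> B"
  moreover have "(radj (A \<union> B))\<^sup>*\<^sup>* x y"
    using assms(3-5) by (auto intro: r_into_rtranclp simp: radj_def)
  moreover have "(radj (A \<union> B))\<^sup>*\<^sup>* x z" if "z \<in> A"
    using connD[OF assms(1,3) that] reach_mono by (metis sup_ge1)
  moreover have "(radj (A \<union> B))\<^sup>*\<^sup>* y z" if "z \<in> B"
    using connD[OF assms(2,4) that] reach_mono by (metis sup_ge2)
  ultimately show "(radj (A \<union> B))\<^sup>*\<^sup>* x z"
    by (meson UnE rtranclp_trans)
qed (use assms in auto)

lemma conn_insert: "conn A \<Longrightarrow> y \<in> A \<Longrightarrow> adj x y \<Longrightarrow> conn (insert x A)"
  using conn_Un[of "{x}" A x y] by simp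

lemma comp_subset: "comp D x \<subseteq> D"
  by (auto simp: comp_def)

lemma comp_self: "x \<in> D \<Longrightarrow> x \<in> comp D x"
  by (simp add: comp_def)

lemma comp_closed: "u \<in> comp D x \<Longrightarrow> v \<in> D \<Longrightarrow> adj u v \<Longrightarrow> v \<in> comp D x"
  by (auto simp: comp_def radj_def intro: rtranclp.rtrancl_into_rtrancl)

lemma conn_comp:
  assumes "x \<in> D" shows "conn (comp D x)"
proof (rule connI[of x])
  fix y assume "y \<in> comp D x"
  then have "(radj D)\<^sup>*\<^sup>* x y" by (simp add: comp_def)
  then show "(radj (comp D x))\<^sup>*\<^sup>* x y"
  proof (induction rule: rtranclp_induct)
    case (step y z)
    then have "y \<in> comp D x" by (simp add: comp_def radj_def)
    moreover from this have "z \<in> comp D x"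
      using step(2) comp_closed by (auto simp: radj_def)
    ultimately have "radj (comp D x) y z"
      using step(2) by (simp add: radj_def)
    with step(3) show ?case by (rule rtranclp.rtrancl_into_rtrancl)
  qed auto
qed (use assms in \<open>simp add: comp_self\<close>)

lemma conn_subset_comp:
  assumes "conn A" "A \<subseteq> D" "y \<in> A" "y \<in> comp D x"
  shows "A \<subseteq> comp D x"
proof
  fix z assume "z \<in> A"
  from reach_mono[OF connD[OF assms(1,3) this] assms(2)]
  show "z \<in> comp D x"
    by (rule reach_closed) (use assms comp_closed in \<open>auto simp: radj_def\<close>)
qed

text \<open>A connected proper subset of greatest size misses exactly one vertex: an edge leaving it
  adds a vertex and keeps it connected, so by maximality the enlarged set is all of
  \<open>D\<close>.\<close>

lemma noncut_exists:
  assumes "finite D" "conn D" "\<And>x. D \<noteq> {x}"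
  obtains v where "v \<in> D" "conn (D - {v})"
proof -
  define P where "P A \<longleftrightarrow> conn A \<and> A \<subset> D" for A
  obtain d where "d \<in> D" using assms(2) by (auto simp: conn_def)
  then have "P {d}" using assms(3) by (auto simp: P_def)
  moreover have "\<forall>A. P A \<longrightarrow> card A < Suc (card D)"
    using assms(1) by (auto simp: P_def intro: less_SucI psubset_card_mono)
  ultimately obtain A where A: "P A" "\<And>B. P B \<Longrightarrow> card B \<le> card A"
    using ex_has_greatest_nat[of P "{d}" card "Suc (card D)"] by (metis less_imp_le)
  obtain x y where "x \<in> A" "x \<in> D" "y \<in> D" "y \<notin> A"
    using A(1) unfolding P_def conn_def by blast
  then obtain u v where uv: "u \<in> A" "v \<notin> A" "radj D u v"
    using conn_cross[OF assms(2)] by metis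
  have "conn (insert v A)"
    using A(1) uv by (auto simp: P_def radj_def adj_commute intro: conn_insert)
  moreover have "finite A" using A(1) assms(1) by (auto simp: P_def intro: finite_subset)
  then have "\<not> card (insert v A) \<le> card A" using uv by simp
  ultimately have "insert v A = D"
    using A uv unfolding P_def radj_def by blast
  then have "D - {v} = A" "v \<in> D" using uv by auto
  then show thesis using that A(1) by (metis P_def)
qed

section \<open>Hamiltonian paths and pendant vertices\<close>

lemma traceableI: "distinct p \<Longrightarrow> set p = W \<Longrightarrow> successively adj p \<Longrightarrow> traceable W"
  unfolding traceable_def by blast

lemma successively_adj_rev: "successively adj (rev p) \<longleftrightarrow> successively adj p"
  by (simp add: successively_rev adj_commute)

text \<open>An interior vertex of a Hamiltonian path has two different path neighbours, so a vertex
  with at most one neighbour is an end. After reversing the path if necessary, it comes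
  first.\<close>

lemma traceable_from_pendant:
  assumes "traceable W" "v \<in> W" "s \<in> W" "s \<noteq> v" "\<And>x. x \<in> W \<Longrightarrow> adj v x \<Longrightarrow> x = s"
  obtains t where "distinct (v # s # t)" "set (v # s # t) = W" "successively adj (v # s # t)"
proof -
  obtain p where p: "distinct p" "set p = W" "successively adj p"
    using assms(1) by (auto simp: traceable_def)
  obtain xs ys where xy: "p = xs @ v # ys"
    using assms(2) p(2) by (metis split_list)
  note result = that
  have *: thesis if "distinct (v # q)" "set (v # q) = W" "successively adj (v # q)" for q
  proof (cases q)
    case Nil
    then show ?thesis using that assms by auto
  next
    case (Cons c q')
    then have "c = s" using that assms(5) by auto
    then show ?thesis using that Cons result by blast
  qed
  consider "xs = []" | "ys = []" | "xs \<noteq> []" "ys \<noteq> []" by blast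
  then show thesis
  proof cases
    case 1
    then show ?thesis using * p xy by simp
  next
    case 2
    have "rev p = v # rev xs" using 2 xy by simp
    then show ?thesis using *[of "rev xs"] p by (metis distinct_rev set_rev successively_adj_rev)
  next
    case 3
    then have "adj (last xs) v" "adj v (hd ys)"
      using p(3) xy by (auto simp: successively_append_iff successively_Cons)
    then have "last xs = s" "hd ys = s"
      using assms(5) p(2) xy 3 by (auto simp: adj_commute)
    then show ?thesis
      using 3 p(1) xy by (metis disjoint_iff distinct_append last_in_set list.set_intros(2) hd_in_set)
  qed
qed

lemma clique_path:
  assumes "finite K" "\<And>x y. x \<in> K \<Longrightarrow> y \<in> K \<Longrightarrow> x \<noteq> y \<Longrightarrow> adj x y"
  shows "\<exists>p. distinct p \<and> set p = K \<and> successively adj p"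
proof -
  obtain p where p: "set p = K" "distinct p"
    using finite_distinct_list[OF assms(1)] by blast
  have "successively adj q" if "distinct q" "set q \<subseteq> K" for q
    using that
  proof (induction q)
    case (Cons x q)
    then show ?case using assms(2) by (cases q) auto
  qed simp
  then show ?thesis using p by blast
qed

lemma conn_remove_pendant:
  assumes "conn W" "s \<in> W" "s \<noteq> v" "\<And>x. x \<in> W \<Longrightarrow> adj v x \<Longrightarrow> x = s"
  shows "conn (W - {v})"
proof (rule connI[of s])
  fix y assume y: "y \<in> W - {v}"
  have "(radj W)\<^sup>*\<^sup>* s y" using connD[OF assms(1,2)] y by blast
  then have "y \<in> {y. y \<noteq> v \<longrightarrow> (radj (W - {v}))\<^sup>*\<^sup>* s y}"
  proof (rule reach_closed)
    fix x z assume xz: "x \<in> {y. y \<noteq> v \<longrightarrow> (radj (W - {v}))\<^sup>*\<^sup>* s y}" "radj W x z"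
    show "z \<in> {y. y \<noteq> v \<longrightarrow> (radj (W - {v}))\<^sup>*\<^sup>* s y}"
    proof (cases "x = v \<or> z = v")
      case True
      then show ?thesis using xz(2) assms(4)[of z] by (auto simp: radj_def)
    next
      case False
      then have "radj (W - {v}) x z" using xz(2) by (simp add: radj_def)
      then show ?thesis using xz(1) False by (simp add: rtranclp.rtrancl_into_rtrancl)
    qed
  qed simp
  then show "(radj (W - {v}))\<^sup>*\<^sup>* s y" using y by simp
qed (use assms in simp)

text \<open>The exceptional case in the induction for traceability; the cases follow the size of
  \<open>K\<close>, the set of neighbours of \<open>s\<close> besides \<open>v\<close>.\<close>

lemma traceable_pendant:
  assumes IH: "\<And>X. X \<subset> W \<Longrightarrow> conn X \<Longrightarrow> traceable X"
    and W: "conn W" "core_free W" "finite W"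
    and v: "v \<in> W" "s \<in> W" "adj v s" "\<And>x. x \<in> W \<Longrightarrow> adj v x \<Longrightarrow> x = s"
  shows "traceable W"
proof -
  define K where "K = {x \<in> W. adj s x \<and> x \<noteq> v}"
  have sv: "s \<noteq> v" "adj s v" using v(3) by (auto simp: adj_commute)
  \<comment> \<open>Two nonadjacent vertices of \<open>K\<close> would form a claw at
    \<open>s\<close> together with \<open>v\<close>.\<close>
  have clique: "adj x y" if "x \<in> K" "y \<in> K" "x \<noteq> y" for x y
  proof -
    have "adj v x \<or> adj v y \<or> adj x y"
      by (rule no_claw[OF W(2), of s]) (use that v(1-3) sv in \<open>auto simp: K_def\<close>)
    then show ?thesis using that v(4)[of x] v(4)[of y] sv by (auto simp: K_def)
  qed
  consider "K = {}" | \<kappa> where "K = {\<kappa>}" | \<kappa>1 \<kappa>2 where "\<kappa>1 \<in> K" "\<kappa>2 \<in> K" "\<kappa>1 \<noteq> \<kappa>2"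
    by (metis insertI1 is_singletonI' is_singleton_the_elem)
  then show ?thesis
  proof cases
    case 1
    have "W = {v, s}"
    proof (rule ccontr)
      assume "W \<noteq> {v, s}"
      then obtain y where "y \<in> W" "y \<notin> {v, s}" using v(1-3) by auto
      then obtain x y where "x \<in> {v, s}" "y \<notin> {v, s}" "radj W x y"
        using conn_cross[OF W(1), of v "{v, s}"] v(1-3) by (metis insertI1)
      then show False using 1 by (auto simp: K_def radj_def dest: v(4))
    qed
    then show ?thesis using v(3) sv by (intro traceableI[of "[v, s]"]) auto
  next
    case (2 \<kappa>)
    have K: "\<kappa> \<in> W" "adj s \<kappa>" "\<kappa> \<noteq> v" using 2 by (auto simp: K_def)
    \<comment> \<open>Without \<open>v\<close>, the vertex \<open>s\<close> is itself pendant, so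
      some Hamiltonian path of the rest starts at \<open>s\<close>, and \<open>v\<close> goes in
      front.\<close>
    have "conn (W - {v})"
      using conn_remove_pendant[OF W(1) v(2) sv(1) v(4)] .
    then have "traceable (W - {v})" using IH v(1-3) by blast
    then obtain t where t: "distinct (s # \<kappa> # t)" "set (s # \<kappa> # t) = W - {v}"
      "successively adj (s # \<kappa> # t)"
      by (rule traceable_from_pendant[of _ s \<kappa>]) (use 2 K v(1-3) sv in \<open>auto simp: K_def\<close>)
    then show ?thesis using v(1-3) by (intro traceableI[of "v # s # \<kappa> # t"]) auto
  next
    case (3 \<kappa>1 \<kappa>2)
    show ?thesis
    proof (cases "\<exists>\<kappa>\<in>K. conn (W - {\<kappa>})")
      case True
      then obtain \<kappa> where \<kappa>: "\<kappa> \<in> K" "conn (W - {\<kappa>})" by blast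
      have k: "\<kappa> \<in> W" "\<kappa> \<noteq> s" "\<kappa> \<noteq> v" "adj s \<kappa>" using \<kappa> by (auto simp: K_def)
      obtain \<mu> where \<mu>: "\<mu> \<in> K" "\<mu> \<noteq> \<kappa>" using 3 by metis
      \<comment> \<open>A Hamiltonian path without \<open>\<kappa>\<close> starts with
        \<open>v\<close>, \<open>s\<close> and a further vertex of the clique \<open>K\<close>, so
        \<open>\<kappa>\<close> fits in right after \<open>s\<close>.\<close>
      have "traceable (W - {\<kappa>})" using IH k \<kappa> by blast
      then obtain t where t: "distinct (v # s # t)" "set (v # s # t) = W - {\<kappa>}"
        "successively adj (v # s # t)"
        by (rule traceable_from_pendant[of _ v s]) (use k v(1-3) sv in \<open>auto dest: v(4)\<close>)
      have "t \<noteq> []"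
      proof
        assume "t = []"
        then have "\<mu> \<in> {v, s}" using t(2) \<mu> by (auto simp: K_def)
        then show False using \<mu> by (auto simp: K_def)
      qed
      then obtain x t' where x: "t = x # t'" by (cases t) auto
      then have "x \<in> W" "x \<noteq> v" "x \<noteq> \<kappa>" "adj s x" using t by auto
      then have "adj \<kappa> x" using clique \<kappa> by (auto simp: K_def)
      then have "successively adj (v # s # \<kappa> # t)" using t(3) k x by (simp)
      moreover have "distinct (v # s # \<kappa> # t)" "set (v # s # \<kappa> # t) = W"
        using t k by auto
      ultimately show ?thesis by (intro traceableI)
    next
      case False
      \<comment> \<open>Here every vertex of \<open>K\<close> is a cut vertex and has a neighbour
        separated from \<open>s\<close>. Two such neighbours and \<open>v\<close>, attached to the
        triangle \<open>s\<close>, \<open>\<kappa>1\<close>, \<open>\<kappa>2\<close>, give an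
        induced net.\<close>
      have ex: "\<exists>a. a \<in> W \<and> adj \<kappa> a \<and> a \<notin> comp (W - {\<kappa>}) s \<and> a \<noteq> \<kappa>" if "\<kappa> \<in> K" for \<kappa>
      proof -
        have k: "\<kappa> \<in> W" "s \<in> W - {\<kappa>}" using that v(1-3) by (auto simp: K_def)
        have "comp (W - {\<kappa>}) s \<noteq> W - {\<kappa>}"
          using False that conn_comp[OF k(2)] by metis
        then obtain y where y: "y \<in> W - {\<kappa>}" "y \<notin> comp (W - {\<kappa>}) s"
          using comp_subset by blast
        obtain u w where "u \<in> - comp (W - {\<kappa>}) s - {\<kappa>}" "w \<notin> - comp (W - {\<kappa>}) s - {\<kappa>}" "radj W u w"
          by (rule conn_cross[OF W(1), of y "- comp (W - {\<kappa>}) s - {\<kappa>}" s])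
            (use y v(1-3) k comp_self[OF k(2)] in auto)
        then show ?thesis
          using comp_closed[of w "W - {\<kappa>}" s u] by (auto simp: radj_def adj_commute)
      qed
      obtain a1 where a1: "a1 \<in> W" "adj \<kappa>1 a1" "a1 \<notin> comp (W - {\<kappa>1}) s" "a1 \<noteq> \<kappa>1" using ex 3 by blast
      obtain a2 where a2: "a2 \<in> W" "adj \<kappa>2 a2" "a2 \<notin> comp (W - {\<kappa>2}) s" "a2 \<noteq> \<kappa>2" using ex 3 by blast
      have k: "\<kappa>1 \<in> W" "\<kappa>2 \<in> W" "adj s \<kappa>1" "adj s \<kappa>2" "adj \<kappa>1 \<kappa>2" "\<kappa>1 \<noteq> s" "\<kappa>2 \<noteq> s" "\<kappa>1 \<noteq> v" "\<kappa>2 \<noteq> v"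
        using 3 clique by (auto simp: K_def)
      have in1: "v \<in> comp (W - {\<kappa>1}) s" "\<kappa>2 \<in> comp (W - {\<kappa>1}) s" "s \<in> comp (W - {\<kappa>1}) s"
        and in2: "v \<in> comp (W - {\<kappa>2}) s" "\<kappa>1 \<in> comp (W - {\<kappa>2}) s" "s \<in> comp (W - {\<kappa>2}) s"
        using k v(1-3) sv 3 comp_self[of s] comp_closed[of s] by auto
      have n1: "\<not> adj a1 w" and n1': "\<not> adj w a1" if "w \<in> comp (W - {\<kappa>1}) s" for w
        using comp_closed[OF that, of a1] a1 by (auto simp: adj_commute)
      have n2: "\<not> adj a2 w" and n2': "\<not> adj w a2" if "w \<in> comp (W - {\<kappa>2}) s" for w
        using comp_closed[OF that, of a2] a2 by (auto simp: adj_commute)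
      have "a2 \<noteq> \<kappa>1" using n2 in2 a2 by auto
      then have "a2 \<in> comp (W - {\<kappa>1}) s" using comp_closed[OF in1(2), of a2] a2 by auto
      then have "\<not> adj a1 a2" by (rule n1)
      moreover have "adj v a1 \<or> adj v a2 \<or> adj a1 a2"
        by (rule no_net[OF W(2), of s \<kappa>1 \<kappa>2])
          (use n1'[OF in1(1)] n1'[OF in1(2)] n1'[OF in1(3)] n2'[OF in2(1)] n2'[OF in2(2)] n2'[OF in2(3)]
            k a1 a2 v(1-3) v(4)[of \<kappa>1] v(4)[of \<kappa>2] sv in \<open>auto simp: adj_commute[of _ v]\<close>)
      ultimately show ?thesis using n1'[OF in1(1)] n2'[OF in2(1)] by auto
    qed
  qed
qed

text \<open>The theorem of Duffus, Gould and Jacobson. If \<open>W\<close> is not complete, take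
  \<open>v\<close> and a component \<open>H\<close> of its non-neighbours, with \<open>H\<close> as
  large as possible, and split the rest into the neighbourhood \<open>S\<close> of \<open>H\<close>
  and the remainder \<open>R\<close>. Then \<open>R\<close> is a clique joined completely to
  \<open>S\<close>, and \<open>S\<close> has no three pairwise nonadjacent vertices, so Hamiltonian
  paths of the pieces can be concatenated.\<close>

theorem core_free_traceable:
  assumes "finite W" "conn W" "core_free W"
  shows "traceable W"
  using assms
proof (induction W rule: finite_psubset_induct)
  case (psubset W)
  have IH: "traceable X" if "X \<subset> W" "conn X" for X
    using psubset.IH[OF that] psubset.prems that core_free_mono[of W X] by blast
  show ?case
  proof (cases "\<forall>x\<in>W. \<forall>y\<in>W. x \<noteq> y \<longrightarrow> adj x y")
    case True
    then show ?thesis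
      unfolding traceable_def by (intro clique_path) (use psubset.hyps in auto)
  next
    case False
    define far where "far v = {x \<in> W. x \<noteq> v \<and> \<not> adj v x}" for v
    define P where "P = (\<lambda>(v, H). v \<in> W \<and> (\<exists>x\<in>far v. H = comp (far v) x))"
    obtain v0 x0 where "v0 \<in> W" "x0 \<in> far v0" using False by (auto simp: far_def)
    then have "P (v0, comp (far v0) x0)" by (auto simp: P_def)
    moreover have bound: "\<forall>y. P y \<longrightarrow> card (snd y) < Suc (card W)"
    proof (intro allI impI)
      fix y assume "P y"
      then have "snd y \<subseteq> W" using comp_subset by (fastforce simp: P_def far_def)
      then show "card (snd y) < Suc (card W)"
        using psubset.hyps card_mono by (simp add: less_Suc_eq_le)
    qed
    ultimately obtain vH where P: "P vH" and max0: "\<And>y. P y \<Longrightarrow> card (snd y) \<le> card (snd vH)"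
      using ex_has_greatest_nat[of P "(v0, comp (far v0) x0)" "\<lambda>y. card (snd y)" "Suc (card W)"]
      by (metis less_imp_le)
    obtain v H where vH: "vH = (v, H)" by (cases vH)
    from P obtain h where v: "v \<in> W" and h: "h \<in> far v" and H: "H = comp (far v) h"
      unfolding vH P_def by blast
    have max: "card (comp (far w) x) \<le> card H" if "w \<in> W" "x \<in> far w" for w x
    proof -
      have "P (w, comp (far w) x)" using that unfolding P_def by blast
      from max0[OF this] show ?thesis by (simp add: vH)
    qed
    have HW: "H \<subseteq> far v" "H \<subseteq> W" "h \<in> H" "conn H" "v \<notin> H"
      using comp_subset[of "far v" h] comp_self[OF h] conn_comp[OF h] H by (auto simp: far_def)
    have finH: "finite H" using HW(2) psubset.hyps finite_subset by blast
    define S where "S = {s \<in> W - H. \<exists>y\<in>H. adj s y}"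
    define R where "R = W - H - S"
    have SR: "S \<subseteq> W" "R \<subseteq> W" "H \<inter> S = {}" "H \<inter> R = {}" "S \<inter> R = {}" "W = H \<union> S \<union> R"
      using HW by (auto simp: S_def R_def)
    have RH: "\<not> adj x y" if "x \<in> R" "y \<in> H" for x y
      using that by (auto simp: R_def S_def)
    have vR: "v \<in> R" using v HW(1) HW(5) by (auto simp: R_def S_def far_def)
    \<comment> \<open>A vertex of \<open>S\<close> not adjacent to \<open>v\<close> would have been
      in the component \<open>H\<close>.\<close>
    have vS: "adj v s" if sS: "s \<in> S" for s
    proof (rule ccontr)
      assume "\<not> adj v s"
      then have "s \<in> far v" using that vR SR by (auto simp: far_def)
      moreover obtain y where "y \<in> H" "adj y s" using sS by (auto simp: S_def adj_commute[of s])
      ultimately have "s \<in> H" using comp_closed H by blast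
      then show False using that SR by blast
    qed
    \<comment> \<open>Here maximality enters: if \<open>x\<close> misses \<open>s\<close>, then
      \<open>H\<close> enlarged by \<open>s\<close> lies in one component of the non-neighbours of
      \<open>x\<close>.\<close>
    have RS: "adj x s" if xs: "x \<in> R" "s \<in> S" for x s
    proof (rule ccontr)
      assume neg: "\<not> adj x s"
      obtain y where y: "y \<in> H" "adj s y" using xs by (auto simp: S_def)
      have sub: "insert s H \<subseteq> far x"
        using that neg SR RH by (auto simp: far_def)
      have "conn (insert s H)" using conn_insert[OF HW(4) y] .
      then have "insert s H \<subseteq> comp (far x) s"
        by (rule conn_subset_comp[of _ _ s]) (use sub comp_self[of s "far x"] in auto)
      moreover have "finite (comp (far x) s)"
        using psubset.hyps comp_subset[of "far x" s] by (auto simp: far_def intro: finite_subset)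
      ultimately have "card (insert s H) \<le> card (comp (far x) s)" by (simp add: card_mono)
      also have "\<dots> \<le> card H" using max[of x s] sub that SR by auto
      finally show False using xs(2) SR(3) finH by (auto simp: card_insert_if split: if_splits)
    qed
    obtain u w where "u \<in> H" "w \<notin> H" "radj W u w"
      by (rule conn_cross[OF psubset.prems(1), of h H v]) (use HW v in auto)
    then have "w \<in> S" by (auto simp: S_def radj_def adj_commute[of w])
    then obtain s0 where s0: "s0 \<in> S" by blast
    \<comment> \<open>Otherwise there is a claw at \<open>s0\<close> with its third leaf in
      \<open>H\<close>.\<close>
    have Rclique: "adj x y" if xy: "x \<in> R" "y \<in> R" "x \<noteq> y" for x y
    proof -
      obtain z where z: "z \<in> H" "adj s0 z" using s0 by (auto simp: S_def)
      have "adj z x \<or> adj z y \<or> adj x y"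
        by (rule no_claw[OF psubset.prems(2), of s0])
          (use xy z s0 SR RS[OF xy(1) s0] RS[OF xy(2) s0] in \<open>auto simp: adj_commute[of s0]\<close>)
      then show ?thesis using RH[OF xy(1) z(1)] RH[OF xy(2) z(1)] by (auto simp: adj_commute[of z])
    qed
    have Sindep: "adj x y \<or> adj x z \<or> adj y z" if "{x, y, z} \<subseteq> S" "x \<noteq> y" "x \<noteq> z" "y \<noteq> z" for x y z
      by (rule no_claw[OF psubset.prems(2), of v]) (use that v SR vS in auto)
    obtain r where r: "distinct r" "set r = R" "successively adj r"
      using clique_path[of R] Rclique psubset.hyps SR(2) finite_subset by metis
    have rne: "r \<noteq> []" using r vR by auto
    show ?thesis
    proof (cases "S = {s0} \<and> R = {v}")
      case True
      show ?thesis
        by (rule traceable_pendant[OF IH psubset.prems psubset.hyps, of v s0])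
          (use True SR v s0 vS RH[OF vR] in auto)
    next
      case False
      \<comment> \<open>In the set \<open>H\<close> with \<open>s\<close> and \<open>v\<close>
        added, \<open>v\<close> is pendant at \<open>s\<close>, so the path from the induction
        hypothesis starts \<open>v\<close>, \<open>s\<close> and then traverses \<open>H\<close>.
        The case set aside before is the one where this set is all of \<open>W\<close>.\<close>
      have Hpath: "\<exists>t. distinct (s # t) \<and> set (s # t) = insert s H \<and> successively adj (s # t)"
        if s: "s \<in> S" for s
      proof -
        obtain y where y: "y \<in> H" "adj s y" using s by (auto simp: S_def)
        have sv: "s \<noteq> v" "s \<in> W" using s vR SR by auto
        have "conn (insert v (insert s H))"
          using conn_insert[OF conn_insert[OF HW(4) y], of s v] vS[OF s] by auto
        moreover have "insert v (insert s H) \<noteq> W"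
        proof
          assume eq: "insert v (insert s H) = W"
          have "x = s" if "x \<in> S" for x
            using that SR(1,3,5) vR unfolding eq[symmetric] by auto
          moreover have "x = v" if "x \<in> R" for x
            using that SR(2,4,5) s unfolding eq[symmetric] by auto
          ultimately have "S = {s0}" "R = {v}" using s0 vR s by blast+
          then show False using False by auto
        qed
        ultimately have "traceable (insert v (insert s H))"
          using IH[of "insert v (insert s H)"] v sv HW(2) by blast
        then obtain t where "distinct (v # s # t)" "set (v # s # t) = insert v (insert s H)"
          "successively adj (v # s # t)"
          by (rule traceable_from_pendant[of _ v s]) (use sv RH[OF vR] in auto)
        then show ?thesis using HW(5) sv by (intro exI[of _ t]) auto
      qed
      show ?thesis
      proof (cases "conn S")
        case True
        \<comment> \<open>For connected \<open>S\<close> the pieces are traversed in the order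
          \<open>R\<close>, \<open>S\<close>, \<open>H\<close>; the path of \<open>S\<close> ends in
          some \<open>s\<close>, from which \<open>Hpath\<close> continues.\<close>
        have "traceable S" using IH[OF _ True] SR v vR by blast
        then obtain p where p: "distinct p" "set p = S" "successively adj p"
          by (auto simp: traceable_def)
        then obtain q s where q: "p = q @ [s]" using s0 by (cases p rule: rev_cases) auto
        then have "s \<in> S" using p by auto
        from Hpath[OF this] obtain t where t: "distinct (s # t)" "set (s # t) = insert s H"
          "successively adj (s # t)" by blast
        have "adj (last r) (hd (p @ t))" using RS p q r rne
          by (metis append_Nil append_is_Nil_conv hd_append2 hd_in_set last_in_set not_Cons_self2)
        moreover have "successively adj (p @ t)" using p q t
          by (cases t) (auto simp: successively_append_iff)
        ultimately have "successively adj (r @ p @ t)" using r rne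
          by (auto simp: successively_append_iff)
        moreover have st: "set t = H" using t SR \<open>s \<in> S\<close> by auto
        have "distinct (r @ p @ t)" using r p t st SR by auto
        moreover have "set (r @ p @ t) = W" using st r p SR by auto
        ultimately show ?thesis by (intro traceableI)
      next
        case False
        \<comment> \<open>A disconnected \<open>S\<close> splits into two cliques, since it has no
          three pairwise nonadjacent vertices. The clique \<open>R\<close> bridges them: the order
          is \<open>S1\<close>, \<open>R\<close>, \<open>S2\<close>, \<open>H\<close>.\<close>
        define S1 where "S1 = comp S s0"
        define S2 where "S2 = S - S1"
        have s01: "s0 \<in> S1" and S1: "S1 \<subseteq> S" using s0 comp_self comp_subset by (auto simp: S1_def)
        have "S1 \<noteq> S" using False conn_comp[OF s0] by (auto simp: S1_def)
        then obtain s2 where s2: "s2 \<in> S2" using S1 by (auto simp: S2_def)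
        have no: "\<not> adj x y" if "x \<in> S1" "y \<in> S2" for x y
          using comp_closed[of x S s0 y] that by (auto simp: S1_def S2_def)
        have c1: "adj x y" if "x \<in> S1" "y \<in> S1" "x \<noteq> y" for x y
          using Sindep[of x y s2] that no s2 S1 by (auto simp: S2_def)
        have c2: "adj x y" if "x \<in> S2" "y \<in> S2" "x \<noteq> y" for x y
          using Sindep[of s0 x y] that no[OF s01] s01 S1 by (auto simp: S2_def)
        have fin: "finite S1" "finite S2" using psubset.hyps SR(1) S1
          by (auto simp: S2_def intro: finite_subset)
        obtain p1 where p1: "distinct p1" "set p1 = S1" "successively adj p1"
          using clique_path[OF fin(1) c1] by blast
        obtain p2 where p2: "distinct p2" "set p2 = S2" "successively adj p2"
          using clique_path[OF fin(2) c2] by blast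
        obtain q s where q: "p2 = q @ [s]" using s2 p2 by (cases p2 rule: rev_cases) auto
        then have s: "s \<in> S" using p2 by (auto simp: S2_def)
        from Hpath[OF this] obtain t where t: "distinct (s # t)" "set (s # t) = insert s H"
          "successively adj (s # t)" by blast
        have ne: "p1 \<noteq> []" using p1 s01 by auto
        have a1: "adj (last p1) (hd r)"
          using RS[of "hd r" "last p1"] p1(2) ne r(2) rne S1 last_in_set[OF ne]
          by (auto simp: adj_commute[of "last p1"])
        have "hd (p2 @ t) \<in> S2" using p2 q by (cases q) auto
        then have a2: "adj (last r) (hd (p2 @ t))"
          using RS r rne by (auto simp: S2_def)
        have "successively adj (p2 @ t)" using p2 q t
          by (cases t) (auto simp: successively_append_iff)
        then have "successively adj (p1 @ r @ p2 @ t)"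
          using a1 a2 r rne p1 by (auto simp: successively_append_iff)
        moreover have st: "set t = H" using t SR s by auto
        have "distinct (p1 @ r @ p2 @ t)" using r p1 p2 t st SR S1 by (auto simp: S2_def)
        moreover have "set (p1 @ r @ p2 @ t) = W" using st r p1 p2 SR S1 by (auto simp: S2_def)
        ultimately show ?thesis by (intro traceableI)
      qed
    qed
  qed
qed

section \<open>Distances, spiders and balls\<close>

lemma adj_pow_sym: "(adj ^^ n) x y \<Longrightarrow> (adj ^^ n) y x"
  by (rule relpowp_sym) (simp add: adj_commute)

lemma radj_pow_mono: "(radj D ^^ n) x y \<Longrightarrow> D \<subseteq> E \<Longrightarrow> (radj E ^^ n) x y"
  by (erule relpowp_mono[rotated]) (auto simp: radj_def)

lemma radj_pow_adj: "(radj D ^^ n) x y \<Longrightarrow> (adj ^^ n) x y"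
  by (erule relpowp_mono[rotated]) (auto simp: radj_def)

definition rdist :: "'a set \<Rightarrow> 'a \<Rightarrow> 'a \<Rightarrow> nat" where
  "rdist D x y = (LEAST n. (radj D ^^ n) x y)"

lemma rdist_le: "(radj D ^^ n) x y \<Longrightarrow> rdist D x y \<le> n"
  unfolding rdist_def by (rule Least_le)

lemma rdist_walk:
  assumes "conn D" "x \<in> D" "y \<in> D"
  shows "(radj D ^^ rdist D x y) x y"
proof -
  obtain n where "(radj D ^^ n) x y"
    using connD[OF assms] by (auto simp: rtranclp_power)
  then show ?thesis unfolding rdist_def by (rule LeastI)
qed

lemma geodesic:
  assumes "conn D" "x \<in> D" "y \<in> D"
  obtains f where "f 0 = x" "f (rdist D x y) = y"
    "\<And>i. i < rdist D x y \<Longrightarrow> adj (f i) (f (Suc i))"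
    "\<And>i. i \<le> rdist D x y \<Longrightarrow> f i \<in> D"
    "\<And>i. i \<le> rdist D x y \<Longrightarrow> (radj D ^^ (rdist D x y - i)) (f i) y"
    "inj_on f {..rdist D x y}"
    "\<And>i j. i \<le> rdist D x y \<Longrightarrow> j \<le> rdist D x y \<Longrightarrow> adj (f i) (f j) \<Longrightarrow> i = Suc j \<or> j = Suc i"
proof -
  define n where "n = rdist D x y"
  obtain f where f: "f 0 = x" "f n = y" "\<And>i. i < n \<Longrightarrow> radj D (f i) (f (Suc i))"
    using rdist_walk[OF assms] unfolding relpowp_fun_conv n_def by blast
  have fD: "f i \<in> D" if "i \<le> n" for i
    using that f(1) assms(2) f(3)[of "i - 1"] by (cases i) (auto simp: radj_def)
  have w: "(radj D ^^ (j - i)) (f i) (f j)" if "i \<le> j" "j \<le> n" for i j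
    unfolding relpowp_fun_conv
    using that f(3) by (intro exI[of _ "\<lambda>l. f (i + l)"]) auto
  \<comment> \<open>Replacing the stretch from \<open>f i\<close> to \<open>f j\<close> by
    \<open>l\<close> steps gives a walk of \<open>i + l + (n - j)\<close> steps, which is at least
    \<open>n\<close>. The case \<open>l = 0\<close> excludes repetitions, \<open>l = 1\<close>
    excludes chords.\<close>
  have short: "j \<le> i + l" if "i \<le> n" "j \<le> n" "(radj D ^^ l) (f i) (f j)" for i j l
  proof -
    have "(radj D ^^ (i + l + (n - j))) x y"
      using w[of 0 i] w[of j n] that f(1,2) unfolding relpowp_add by auto
    from rdist_le[OF this] show ?thesis using that unfolding n_def by linarith
  qed
  have inj: "i = j" if "i \<le> n" "j \<le> n" "f i = f j" for i j
    using short[of i j 0] short[of j i 0] that by auto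
  have ind: "i = Suc j \<or> j = Suc i" if "i \<le> n" "j \<le> n" "adj (f i) (f j)" for i j
  proof -
    have "radj D (f i) (f j)" "radj D (f j) (f i)"
      using that fD by (auto simp: radj_def adj_commute)
    then have "j \<le> i + 1" "i \<le> j + 1"
      using short[of i j 1] short[of j i 1] that by auto
    moreover have "i \<noteq> j" using that by auto
    ultimately show ?thesis by linarith
  qed
  show thesis
    by (rule that[of f]; (fold n_def)?)
      (use f fD w[of _ n] inj ind in \<open>auto simp: radj_def inj_on_def\<close>)
qed

lemma rdist_less_card:
  assumes "conn D" "x \<in> D" "y \<in> D" "D \<subseteq> V" "finite V"
  shows "rdist D x y < card V"
proof -
  obtain f where "\<And>i. i \<le> rdist D x y \<Longrightarrow> f i \<in> D" "inj_on f {..rdist D x y}"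
    using geodesic[OF assms(1-3)] by metis
  then have "card {..rdist D x y} \<le> card V"
    using assms(4,5) by (intro card_inj_on_le[of f]) auto
  then show ?thesis by simp
qed

text \<open>The subdivided claw (\<open>b\<close> constant) or net (\<open>b\<close> injective); \<open>q i j\<close> has distance \<open>j + 1\<close> from \<open>b i\<close>.\<close>

definition spider :: "nat \<Rightarrow> (nat \<Rightarrow> 'a) \<Rightarrow> (nat \<Rightarrow> nat \<Rightarrow> 'a) \<Rightarrow> bool" where
  "spider k b q \<longleftrightarrow> ((\<forall>i<3. b i = b 0) \<or> inj_on b {..<3}) \<and>
    (\<forall>i<3. \<forall>i'<3. adj (b i) (b i') \<longleftrightarrow> b i \<noteq> b i') \<and>
    (\<forall>i<3. \<forall>i'<3. \<forall>j<k. b i \<noteq> q i' j \<and> (adj (b i) (q i' j) \<longleftrightarrow> j = 0 \<and> b i = b i')) \<and>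
    (\<forall>i<3. \<forall>i'<3. \<forall>j<k. \<forall>j'<k. (q i j = q i' j' \<longleftrightarrow> i = i' \<and> j = j') \<and>
      (adj (q i j) (q i' j') \<longleftrightarrow> i = i' \<and> (j = Suc j' \<or> j' = Suc j)))"

text \<open>Each leg consists of the first \<open>k\<close> vertices of a geodesic inside
  \<open>A i\<close> from \<open>a i\<close> to \<open>e i\<close>; \<open>long\<close> guarantees
  at least \<open>k - 1\<close> edges on it.\<close>

lemma spider_of_legs:
  assumes core: "core b a" and k: "1 \<le> k"
    and A: "\<And>i. i < 3 \<Longrightarrow> conn (A i)" "\<And>i. i < 3 \<Longrightarrow> a i \<in> A i" "\<And>i. i < 3 \<Longrightarrow> e i \<in> A i"
    and long: "\<And>i n. i < 3 \<Longrightarrow> (radj (A i) ^^ n) (a i) (e i) \<Longrightarrow> k \<le> Suc n"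
    and anti: "\<And>i j x y. i < 3 \<Longrightarrow> j < 3 \<Longrightarrow> i \<noteq> j \<Longrightarrow> x \<in> A i \<Longrightarrow> y \<in> A j \<Longrightarrow> x \<noteq> y \<and> \<not> adj x y"
    and bA: "\<And>i j x. i < 3 \<Longrightarrow> j < 3 \<Longrightarrow> x \<in> A i \<Longrightarrow> b j \<noteq> x \<and> (adj (b j) x \<longrightarrow> x = a i)"
  shows "\<exists>q. spider k b q"
proof -
  define L where "L i p \<longleftrightarrow> p 0 = a i \<and> (\<forall>j<k. p j \<in> A i) \<and> inj_on p {..<k} \<and>
      (\<forall>j<k. \<forall>j'<k. adj (p j) (p j') \<longleftrightarrow> j = Suc j' \<or> j' = Suc j)" for i p
  have "\<exists>p. L i p" if i: "i < 3" for i
  proof -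
    define n where "n = rdist (A i) (a i) (e i)"
    have n: "k \<le> Suc n"
      unfolding n_def by (rule long[OF i rdist_walk]) (use A i in auto)
    obtain f where f: "f 0 = a i" "\<And>j. j < n \<Longrightarrow> adj (f j) (f (Suc j))"
      "\<And>j. j \<le> n \<Longrightarrow> f j \<in> A i" "inj_on f {..n}"
      "\<And>j j'. j \<le> n \<Longrightarrow> j' \<le> n \<Longrightarrow> adj (f j) (f j') \<Longrightarrow> j = Suc j' \<or> j' = Suc j"
      using geodesic[OF A(1)[OF i] A(2)[OF i] A(3)[OF i]] unfolding n_def by metis
    have "inj_on f {..<k}" using f(4) by (rule inj_on_subset) (use n in auto)
    moreover have "adj (f j) (f j') \<longleftrightarrow> j = Suc j' \<or> j' = Suc j" if "j < k" "j' < k" for j j'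
    proof
      assume "j = Suc j' \<or> j' = Suc j"
      then show "adj (f j) (f j')"
        using f(2)[of j] f(2)[of j'] that n by (auto simp: adj_commute)
    qed (use f(5) that n in auto)
    moreover have "\<forall>j<k. f j \<in> A i" using f(3) n by auto
    ultimately show ?thesis using f(1) unfolding L_def by blast
  qed
  then have "\<exists>q. \<forall>i. i < 3 \<longrightarrow> L i (q i)" by (intro choice) blast
  then obtain q where q: "\<And>i. i < 3 \<Longrightarrow> q i 0 = a i" "\<And>i j. i < 3 \<Longrightarrow> j < k \<Longrightarrow> q i j \<in> A i"
    "\<And>i. i < 3 \<Longrightarrow> inj_on (q i) {..<k}"
    "\<And>i j j'. i < 3 \<Longrightarrow> j < k \<Longrightarrow> j' < k \<Longrightarrow> adj (q i j) (q i j') \<longleftrightarrow> j = Suc j' \<or> j' = Suc j"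
    unfolding L_def by blast
  have "b i \<noteq> q i' j \<and> (adj (b i) (q i' j) \<longleftrightarrow> j = 0 \<and> b i = b i')"
    if "i < 3" "i' < 3" "j < k" for i i' j
  proof -
    have "adj (b i) (a i') \<longleftrightarrow> b i = b i'" using core that unfolding core_def by blast
    moreover have "j = 0" if "q i' j = a i'"
      using inj_onD[OF q(3)[OF \<open>i' < 3\<close>], of j 0] q(1)[OF \<open>i' < 3\<close>] that \<open>j < k\<close> k by auto
    ultimately show ?thesis
      using bA[OF that(2,1) q(2)[OF that(2,3)]] q(1)[OF that(2)] by metis
  qed
  moreover have "(q i j = q i' j' \<longleftrightarrow> i = i' \<and> j = j') \<and>
      (adj (q i j) (q i' j') \<longleftrightarrow> i = i' \<and> (j = Suc j' \<or> j' = Suc j))"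
    if "i < 3" "i' < 3" "j < k" "j' < k" for i i' j j'
  proof (cases "i = i'")
    case True
    then show ?thesis using q(4)[of i j j'] inj_onD[OF q(3)[OF that(1)], of j j'] that by auto
  next
    case False
    then show ?thesis using anti[OF that(1,2) False q(2)[OF that(1,3)] q(2)[OF that(2,4)]] by auto
  qed
  ultimately have "spider k b q" using core unfolding core_def spider_def by blast
  then show ?thesis by blast
qed

section \<open>Unions, bounded distance and balls\<close>

lemma conn_UN:
  assumes "conn A" "\<And>l. l \<in> S \<Longrightarrow> conn (A \<union> B l)"
  shows "conn (A \<union> (\<Union>l\<in>S. B l))"
proof -
  obtain a where a: "a \<in> A" using assms(1) by (auto simp: conn_def)
  show ?thesis
  proof (rule connI[of a])
    fix y assume "y \<in> A \<union> (\<Union>l\<in>S. B l)"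
    then consider "y \<in> A" | l where "l \<in> S" "y \<in> B l" by blast
    then show "(radj (A \<union> (\<Union>l\<in>S. B l)))\<^sup>*\<^sup>* a y"
    proof cases
      case 1
      show ?thesis by (rule reach_mono[OF connD[OF assms(1) a 1]]) auto
    next
      case (2 l)
      show ?thesis
        by (rule reach_mono[OF connD[OF assms(2)[OF 2(1)], of a y]]) (use a 2 in auto)
    qed
  qed (use a in auto)
qed

text \<open>The bound is strict: \<open>near k x y\<close> says that \<open>x\<close> and \<open>y\<close> have distance at most \<open>k - 1\<close>.\<close>

definition near :: "nat \<Rightarrow> 'a \<Rightarrow> 'a \<Rightarrow> bool" where
  "near n x y \<longleftrightarrow> (\<exists>m<n. (adj ^^ m) x y)"

lemma near_sym: "near n x y \<Longrightarrow> near n y x"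
  unfolding near_def using adj_pow_sym by blast

text \<open>\<open>Suc m\<close> allows distance \<open>m\<close> and \<open>n\<close> allows
  distance \<open>n - 1\<close>; the sum is still strictly below \<open>m + n\<close>.\<close>

lemma near_trans: "near (Suc m) x y \<Longrightarrow> near n y z \<Longrightarrow> near (m + n) x z"
  unfolding near_def
proof (elim exE conjE)
  fix m' n' assume "m' < Suc m" "(adj ^^ m') x y" "n' < n" "(adj ^^ n') y z"
  then show "\<exists>l<m + n. (adj ^^ l) x z"
    by (intro exI[of _ "m' + n'"]) (auto simp: relpowp_add)
qed

lemma near_refl: "near (Suc n) x x"
  unfolding near_def by (intro exI[of _ 0]) auto

lemma near_adj: "adj x y \<Longrightarrow> near n y z \<Longrightarrow> near (Suc n) x z"
  unfolding near_def by (meson Suc_less_eq relpowp_Suc_I2)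

lemma near_mono: "near m x y \<Longrightarrow> m \<le> n \<Longrightarrow> near n x y"
  unfolding near_def by (meson order_less_le_trans)

lemma near_split:
  assumes "near (m + n) x z" "0 < n"
  shows "\<exists>y. near (Suc m) x y \<and> near n y z"
proof -
  obtain l where l: "l < m + n" "(adj ^^ l) x z" using assms(1) by (auto simp: near_def)
  \<comment> \<open>The walk is cut after \<open>m\<close> steps, or at its end if it is shorter;
    \<open>0 < n\<close> then admits the empty remainder.\<close>
  define i where "i = min l m"
  have "(adj ^^ (i + (l - i))) x z" using l by (simp add: i_def)
  then obtain y where "(adj ^^ i) x y" "(adj ^^ (l - i)) y z" unfolding relpowp_add by blast
  moreover have "i < Suc m" "l - i < n" using l assms(2) by (auto simp: i_def)
  ultimately show ?thesis unfolding near_def by blast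
qed

text \<open>The radius is \<open>n - 1\<close>. The balls used below are
  \<open>pball (k - 1)\<close>, of radius \<open>k - 2\<close>, and empty for
  \<open>k = 1\<close>.\<close>

definition pball :: "nat \<Rightarrow> 'a \<Rightarrow> 'a set" where
  "pball n x = {y. near n x y}"

lemma conn_pball:
  assumes "0 < n" shows "conn (pball n x)"
proof (rule connI[of x])
  show "x \<in> pball n x" using assms near_refl[of "n - 1"] by (simp add: pball_def)
  have "(radj (pball n x))\<^sup>*\<^sup>* x y" if "(adj ^^ m) x y" "m < n" for m y
    using that
  proof (induction m arbitrary: y)
    case (Suc m)
    from Suc.prems(1) obtain w where w: "(adj ^^ m) x w" "adj w y" by (rule relpowp_Suc_E)
    have "near n x w" "near n x y"
      using w(1) Suc.prems unfolding near_def by (auto intro: Suc_lessD simp del: relpowp.simps)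
    then have "radj (pball n x) w y"
      using w(2) unfolding radj_def pball_def by simp
    then show ?case using Suc.IH[OF w(1)] Suc.prems(2) by (simp add: rtranclp.rtrancl_into_rtrancl)
  qed simp
  then show "(radj (pball n x))\<^sup>*\<^sup>* x y" if "y \<in> pball n x" for y
    using that by (auto simp: pball_def near_def)
qed

text \<open>A vertex within distance \<open>n\<close> of \<open>X\<close> is linked to \<open>X\<close> by its ball of radius \<open>n - 1\<close>;
  for \<open>n = 0\<close> that ball is empty and the vertex lies in \<open>X\<close> itself.\<close>

lemma conn_Un_pball:
  assumes "conn X" "x \<in> X" "near (Suc n) x u"
  shows "conn (X \<union> pball n u)" "u \<in> X \<union> pball n u"
proof -
  obtain m where m: "m < Suc n" "(adj ^^ m) x u" using assms(3) by (auto simp: near_def)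
  have "conn (X \<union> pball n u) \<and> u \<in> X \<union> pball n u"
  proof (cases n)
    case 0
    then show ?thesis using m assms by (auto simp: pball_def near_def)
  next
    case (Suc l)
    have u: "u \<in> pball n u" using near_refl by (simp add: pball_def Suc)
    have "\<exists>y\<in>pball n u. x = y \<or> adj x y"
    proof (cases m)
      case 0
      then show ?thesis using m u by auto
    next
      case (Suc m')
      then obtain y where "adj x y" "(adj ^^ m') y u" using m relpowp_Suc_D2 by metis
      moreover from this have "near n u y" using m Suc adj_pow_sym by (auto simp: near_def)
      ultimately show ?thesis by (auto simp: pball_def)
    qed
    then show ?thesis using conn_Un[OF assms(1) conn_pball _ _] assms(2) u Suc by auto
  qed
  then show "conn (X \<union> pball n u)" "u \<in> X \<union> pball n u" by auto
qed

end

section \<open>Claws and nets in minimal covers\<close>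

locale core_in = sym_graph +
  fixes D :: "'a set" and b a :: "nat \<Rightarrow> 'a"
  assumes conn_D: "conn D" and core_ba: "core b a"
    and b_in: "i < 3 \<Longrightarrow> b i \<in> D" and a_in: "i < 3 \<Longrightarrow> a i \<in> D"
begin

text \<open>The component that keeps the rest of the core once \<open>a i\<close> is deleted; see
  \<open>b_in_M\<close> and \<open>a_in_M\<close>.\<close>

definition M :: "nat \<Rightarrow> 'a set" where
  "M i = comp (D - {a i}) (b i)"

text \<open>The part cut off by \<open>a i\<close>, with \<open>a i\<close> itself; it is just
  \<open>{a i}\<close> if \<open>a i\<close> is not a cut vertex of \<open>D\<close>.\<close>

definition X :: "nat \<Rightarrow> 'a set" where
  "X i = D - M i"

lemma core_adj:
  assumes "i < 3" "j < 3"
  shows "adj (b i) (b j) \<longleftrightarrow> b i \<noteq> b j" "adj (b i) (a j) \<longleftrightarrow> b i = b j" "\<not> adj (a i) (a j)"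
    "a i = a j \<longleftrightarrow> i = j"
  using core_ba assms unfolding core_def by (auto dest: inj_onD)

text \<open>An equality \<open>b i = a j\<close> forces \<open>b i \<noteq> b j\<close>, hence a
  net; its third branch vertex would be adjacent to \<open>b i\<close> but not to
  \<open>a j\<close>.\<close>

lemma b_ne_a:
  assumes "i < 3" "j < 3" shows "b i \<noteq> a j"
proof
  assume eq: "b i = a j"
  have bij: "b i \<noteq> b j" using core_adj(2)[OF assms(2) assms(2)] eq core_adj(1)[OF assms(2,1)] by auto
  have "(\<forall>i<3. b i = b 0) \<or> inj_on b {..<3}" using core_ba by (simp add: core_def)
  with bij have inj: "inj_on b {..<3}" using assms by metis
  obtain l :: nat where l: "l < 3" "l \<noteq> i" "l \<noteq> j"
  proof (cases "0 \<noteq> i \<and> 0 \<noteq> j")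
    case False
    then show thesis using that[of 1] that[of 2] assms by (cases "1 \<noteq> i \<and> 1 \<noteq> j") auto
  qed (use that[of 0] in auto)
  have "b l \<noteq> b i" "b l \<noteq> b j" using inj l assms by (auto dest: inj_onD)
  then show False using core_adj(1)[OF l(1) assms(1)] core_adj(2)[OF l(1) assms(2)] eq by auto
qed

lemma M_sub: "M i \<subseteq> D - {a i}"
  unfolding M_def by (rule comp_subset)

lemma X_sub: "X i \<subseteq> D"
  by (auto simp: X_def)

lemma D_cases: "x \<in> D \<Longrightarrow> x \<notin> M i \<Longrightarrow> x \<in> X i"
  by (simp add: X_def)

lemma X_not_M: "x \<in> X i \<Longrightarrow> x \<notin> M i"
  by (simp add: X_def)

lemma b_in_M:
  assumes "i < 3" "j < 3" shows "b j \<in> M i"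
proof -
  have bi: "b i \<in> M i" unfolding M_def using b_in b_ne_a assms by (intro comp_self) auto
  show ?thesis
  proof (cases "b i = b j")
    case False
    then show ?thesis using comp_closed[of "b i" "D - {a i}" "b i" "b j"] bi
        core_adj(1)[OF assms] b_in[OF assms(2)] b_ne_a[OF assms(2,1)] by (auto simp: M_def)
  qed (use bi in simp)
qed

lemma a_in_M:
  assumes "i < 3" "j < 3" "i \<noteq> j" shows "a j \<in> M i"
  using comp_closed[of "b j" "D - {a i}" "b i" "a j"] b_in_M[OF assms(1,2)]
    core_adj(2)[OF assms(2,2)] core_adj(4)[OF assms(1,2)] a_in[OF assms(2)] assms(3)
  by (auto simp: M_def)

lemma a_in_X: "i < 3 \<Longrightarrow> a i \<in> X i"
  using M_sub a_in by (auto simp: X_def)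

lemma conn_M: "i < 3 \<Longrightarrow> conn (M i)"
  unfolding M_def using b_in b_ne_a by (intro conn_comp) auto

lemma X_M_adj:
  assumes "x \<in> X i" "y \<in> M i" "adj y x" shows "x = a i"
  using comp_closed[of y "D - {a i}" "b i" x] assms X_sub by (auto simp: M_def X_def)

text \<open>By \<open>X_M_adj\<close> the leaf \<open>a i\<close> is the only gate between
  \<open>M i\<close> and \<open>X i\<close>, so a walk from \<open>a i\<close> that strays into
  \<open>M i\<close> comes back to \<open>X i\<close> at \<open>a i\<close>.\<close>

lemma conn_X:
  assumes "i < 3" shows "conn (X i)"
proof (rule connI[of "a i"])
  fix y assume y: "y \<in> X i"
  have "(radj D)\<^sup>*\<^sup>* (a i) y" using connD[OF conn_D a_in[OF assms]] y X_sub by blast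
  then have "y \<in> M i \<union> comp (X i) (a i)"
  proof (rule reach_closed)
    fix u v assume uv: "u \<in> M i \<union> comp (X i) (a i)" "radj D u v"
    show "v \<in> M i \<union> comp (X i) (a i)"
    proof (cases "v \<in> M i")
      case False
      then have v: "v \<in> X i" using uv by (auto simp: X_def radj_def)
      from uv(1) show ?thesis
      proof
        assume "u \<in> M i"
        then have "v = a i" using X_M_adj[OF v] uv by (auto simp: radj_def)
        then show ?thesis using comp_self[OF v] by simp
      next
        assume "u \<in> comp (X i) (a i)"
        then show ?thesis using comp_closed[OF _ v] uv(2) by (auto simp: radj_def)
      qed
    qed simp
  qed (use a_in_X[OF assms] in \<open>simp add: comp_self\<close>)
  then show "(radj (X i))\<^sup>*\<^sup>* (a i) y" using y by (auto simp: X_def comp_def)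
qed (rule a_in_X[OF assms])

text \<open>\<open>X j\<close> is connected, avoids \<open>a i\<close>, and contains
  \<open>a j\<close>, which lies in \<open>M i\<close>.\<close>

lemma X_sub_M:
  assumes "i < 3" "j < 3" "i \<noteq> j" shows "X j \<subseteq> M i"
  unfolding M_def
proof (rule conn_subset_comp[OF conn_X[OF assms(2)]])
  show "a j \<in> X j" "a j \<in> comp (D - {a i}) (b i)"
    using a_in_X a_in_M assms by (auto simp: M_def)
  show "X j \<subseteq> D - {a i}" using a_in_M[of j i] assms by (auto simp: X_def)
qed

lemma X_anticomplete:
  assumes "i < 3" "j < 3" "i \<noteq> j" "x \<in> X i" "y \<in> X j"
  shows "x \<noteq> y \<and> \<not> adj x y"
proof -
  have xy: "x \<in> M j" "y \<in> M i" using X_sub_M[of j i] X_sub_M[of i j] assms by auto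
  have "\<not> adj x y"
  proof
    assume "adj x y"
    then have "x = a i" "y = a j"
      using X_M_adj[OF assms(4) xy(2)] X_M_adj[OF assms(5) xy(1)] adj_commute[of x y] by auto
    then show False using core_adj(3)[OF assms(1,2)] \<open>adj x y\<close> by simp
  qed
  then show ?thesis using xy assms by (auto simp: X_def)
qed

text \<open>A walk from \<open>M i\<close> into \<open>X i\<close> has to pass the gate
  \<open>a i\<close> first.\<close>

lemma rdist_a_le:
  assumes "i < 3" "r \<in> M i" "x \<in> X i"
  shows "rdist D r (a i) \<le> rdist D r x"
proof -
  have "rdist D r (a i) \<le> n" if "(radj D ^^ n) r y" "y \<in> X i" for n y
    using that
  proof (induction n arbitrary: y)
    case 0
    then show ?case using assms(2) X_not_M by auto
  next
    case (Suc n)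
    from Suc.prems(1) obtain z where z: "(radj D ^^ n) r z" "radj D z y" by (rule relpowp_Suc_E)
    show ?case
    proof (cases "z \<in> M i")
      case True
      then have "y = a i" using X_M_adj[OF Suc.prems(2)] z(2) by (auto simp: radj_def)
      then show ?thesis using rdist_le Suc.prems(1) by blast
    next
      case False
      then have "z \<in> X i" using z(2) by (auto simp: X_def radj_def)
      then show ?thesis using Suc.IH[OF z(1)] by simp
    qed
  qed
  moreover have "(radj D ^^ rdist D r x) r x"
    using assms M_sub X_sub by (intro rdist_walk[OF conn_D]) auto
  ultimately show ?thesis using assms(3) by blast
qed

end

section \<open>Pendant paths and the lexicographic potential\<close>

context sym_graph
begin

text \<open>The root \<open>\<eta> 0\<close> may have any further neighbours in \<open>D\<close>.
  For \<open>N = 0\<close> the tail is its root alone.\<close>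

definition tail :: "'a set \<Rightarrow> (nat \<Rightarrow> 'a) \<Rightarrow> nat \<Rightarrow> bool" where
  "tail D \<eta> N \<longleftrightarrow> \<eta> ` {..N} \<subseteq> D \<and> inj_on \<eta> {..N} \<and> (\<forall>j<N. adj (\<eta> j) (\<eta> (Suc j))) \<and>
    (\<forall>j\<in>{1..N}. \<forall>x\<in>D. adj (\<eta> j) x \<longrightarrow> x = \<eta> (j - 1) \<or> (j < N \<and> x = \<eta> (Suc j)))"

lemma tail_nbr:
  assumes "tail D \<eta> N" "1 \<le> j" "j \<le> N" "x \<in> D" "adj (\<eta> j) x"
  shows "x = \<eta> (j - 1) \<or> (j < N \<and> x = \<eta> (Suc j))"
  using assms unfolding tail_def by auto

lemma tail_exit:
  assumes "tail D \<eta> N" "y \<in> \<eta> ` {1..N}" "x \<in> D" "x \<notin> \<eta> ` {1..N}" "adj y x"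
  shows "y = \<eta> 1" "x = \<eta> 0"
proof -
  obtain j where j: "1 \<le> j" "j \<le> N" "y = \<eta> j" using assms(2) by auto
  have "x \<noteq> \<eta> (Suc j)" if "j < N" using that assms(4) by auto
  then have x: "x = \<eta> (j - 1)" using tail_nbr[OF assms(1) j(1,2) assms(3)] assms(5) j by auto
  moreover have "j = 1"
  proof (rule ccontr)
    assume "j \<noteq> 1"
    then have "j - 1 \<in> {1..N}" using j by auto
    then show False using x assms(4) by blast
  qed
  ultimately show "y = \<eta> 1" "x = \<eta> 0" using j by auto
qed

text \<open>Induction on the length: the vertex before \<open>\<eta> j\<close> is
  \<open>\<eta> (j - 1)\<close> or \<open>\<eta> (Suc j)\<close>, and the latter takes even more
  steps to reach.\<close>

lemma tail_walk_length:
  assumes "tail D \<eta> N" "x \<notin> \<eta> ` {1..N}"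
  shows "(radj D ^^ n) x (\<eta> j) \<Longrightarrow> j \<le> N \<Longrightarrow> j \<le> n"
proof (induction n arbitrary: j)
  case 0
  then show ?case using assms(2) by (cases j) auto
next
  case (Suc n)
  show ?case
  proof (cases j)
    case (Suc i)
    from Suc.prems(1) obtain z where z: "(radj D ^^ n) x z" "radj D z (\<eta> j)" by (rule relpowp_Suc_E)
    have "z = \<eta> i \<or> (j < N \<and> z = \<eta> (Suc j))"
      using tail_nbr[OF assms(1), of j z] z(2) Suc Suc.prems by (auto simp: radj_def adj_commute)
    then have "i \<le> n" using Suc.IH[of i] Suc.IH[of "Suc j"] z(1) Suc Suc.prems by auto
    then show ?thesis using Suc by simp
  qed simp
qed

lemma conn_remove_tail:
  assumes "conn D" "tail D \<eta> N"
  shows "conn (D - \<eta> ` {1..N})" "\<eta> 0 \<in> D - \<eta> ` {1..N}"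
proof -
  show r: "\<eta> 0 \<in> D - \<eta> ` {1..N}"
    using assms(2) unfolding tail_def by (fastforce dest: inj_onD)
  show "conn (D - \<eta> ` {1..N})" (is "conn ?E")
  proof (rule connI[OF r])
    fix y assume y: "y \<in> ?E"
    have "(radj D)\<^sup>*\<^sup>* (\<eta> 0) y" using connD[OF assms(1)] r y by blast
    then have "y \<in> {y. y \<notin> \<eta> ` {1..N} \<longrightarrow> (radj ?E)\<^sup>*\<^sup>* (\<eta> 0) y}"
    proof (rule reach_closed)
      fix u v assume uv: "u \<in> {y. y \<notin> \<eta> ` {1..N} \<longrightarrow> (radj ?E)\<^sup>*\<^sup>* (\<eta> 0) y}" "radj D u v"
      show "v \<in> {y. y \<notin> \<eta> ` {1..N} \<longrightarrow> (radj ?E)\<^sup>*\<^sup>* (\<eta> 0) y}"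
      proof (cases "u \<in> \<eta> ` {1..N} \<or> v \<in> \<eta> ` {1..N}")
        case True
        then show ?thesis using tail_exit(2)[OF assms(2), of u v] uv(2) by (auto simp: radj_def)
      next
        case False
        then have "radj ?E u v" using uv(2) by (simp add: radj_def)
        then show ?thesis using uv(1) False by (simp add: rtranclp.rtrancl_into_rtrancl)
      qed
    qed simp
    then show "(radj ?E)\<^sup>*\<^sup>* (\<eta> 0) y" using y by simp
  qed
qed

text \<open>The base exceeds the number of vertices, so that comparing potentials compares the sizes of
  the distance levels around \<open>r\<close> lexicographically.\<close>

definition potential :: "'a set \<Rightarrow> 'a \<Rightarrow> 'a set \<Rightarrow> nat" where
  "potential V r D = (\<Sum>x\<in>D. (card V + 1) ^ (card V - rdist D r x))"

text \<open>Up to distance \<open>d\<close>, that of \<open>c\<close>, the set \<open>D'\<close> has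
  only old vertices other than \<open>c\<close>, none of them closer than before. The other vertices
  of \<open>D'\<close> are fewer than \<open>card V + 1\<close> and each weighs at most
  \<open>(card V + 1) ^ (card V - d - 1)\<close>, so together they weigh less than \<open>c\<close>
  did.\<close>

lemma potential_less:
  assumes "finite V" "D \<subseteq> V" "D' \<subseteq> V" "conn D" "conn D'" "r \<in> D" "r \<in> D'" "c \<in> D"
    and near: "\<And>x. x \<in> D' \<Longrightarrow> rdist D' r x \<le> rdist D r c \<Longrightarrow>
      x \<in> D \<and> x \<noteq> c \<and> rdist D r x \<le> rdist D' r x"
  shows "potential V r D' < potential V r D"
proof -
  define m where "m = card V"
  define d where "d = rdist D r c"
  define A where "A = {x \<in> D'. rdist D' r x \<le> d}"
  have "A \<subseteq> D'" by (auto simp: A_def)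
  then have fin: "finite D" "finite D'" "finite A" using assms(1-3) by (meson finite_subset)+
  have dm: "d < m" using rdist_less_card[OF assms(4,6,8,2,1)] by (simp add: d_def m_def)
  have AD: "A \<subseteq> D - {c}" using near by (auto simp: A_def d_def)
  have "potential V r D' = (\<Sum>x\<in>A. (m + 1) ^ (m - rdist D' r x)) + (\<Sum>x\<in>D' - A. (m + 1) ^ (m - rdist D' r x))"
    unfolding potential_def m_def[symmetric] using fin(2)
    by (subst sum.subset_diff[of A]) (auto simp: A_def)
  also have "(\<Sum>x\<in>A. (m + 1) ^ (m - rdist D' r x)) \<le> (\<Sum>x\<in>A. (m + 1) ^ (m - rdist D r x))"
  proof (rule sum_mono)
    fix x assume "x \<in> A"
    then have "rdist D r x \<le> rdist D' r x" using near by (auto simp: A_def d_def)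
    then show "(m + 1) ^ (m - rdist D' r x) \<le> (m + 1) ^ (m - rdist D r x)"
      by (intro power_increasing) auto
  qed
  also have "\<dots> \<le> (\<Sum>x\<in>D - {c}. (m + 1) ^ (m - rdist D r x))"
    by (rule sum_mono2) (use AD fin in auto)
  also have "(\<Sum>x\<in>D' - A. (m + 1) ^ (m - rdist D' r x)) < (m + 1) ^ (m - d)"
  proof -
    have "(\<Sum>x\<in>D' - A. (m + 1) ^ (m - rdist D' r x)) \<le> (\<Sum>x\<in>D' - A. (m + 1) ^ (m - d - 1))"
      by (intro sum_mono power_increasing) (auto simp: A_def)
    also have "\<dots> = card (D' - A) * (m + 1) ^ (m - d - 1)" by simp
    also have "\<dots> \<le> m * (m + 1) ^ (m - d - 1)"
      unfolding m_def using assms(1,3) by (intro mult_right_mono card_mono) auto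
    also have "\<dots> < (m + 1) * (m + 1) ^ (m - d - 1)" by simp
    also have "\<dots> = (m + 1) ^ (m - d)" using dm by (simp flip: power_Suc)
    finally show ?thesis .
  qed
  also have "(\<Sum>x\<in>D - {c}. (m + 1) ^ (m - rdist D r x)) + (m + 1) ^ (m - d) = potential V r D"
    unfolding potential_def m_def[symmetric] d_def using fin(1) assms(8)
    by (subst (2) sum.remove[of _ c]) auto
  finally show ?thesis by simp
qed

end

section \<open>Covers with a prescribed tail\<close>

locale distance_cover = sym_graph +
  fixes V :: "'a set" and k :: nat
  assumes finite_V: "finite V" and adj_V: "adj x y \<Longrightarrow> x \<in> V" and conn_V: "conn V"
    and k_pos: "1 \<le> k"
begin

definition covers :: "'a set \<Rightarrow> bool" where
  "covers D \<longleftrightarrow> (\<forall>z\<in>V. \<exists>d\<in>D. near k d z)"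

definition tailed_cover :: "(nat \<Rightarrow> 'a) \<Rightarrow> nat \<Rightarrow> 'a set \<Rightarrow> bool" where
  "tailed_cover \<eta> N D \<longleftrightarrow> D \<subseteq> V \<and> conn D \<and> covers D \<and> tail D \<eta> N"

lemma k_Suc: "Suc (k - 1) = k" "Suc (k - Suc 0) = k"
  using k_pos by simp_all

lemma pow_V: "(adj ^^ n) x y \<Longrightarrow> x \<in> V \<Longrightarrow> y \<in> V"
  using adj_V by (induction n arbitrary: y) (auto simp: adj_commute elim: relpowp_Suc_E)

lemma near_V: "near n x y \<Longrightarrow> x \<in> V \<Longrightarrow> y \<in> V"
  unfolding near_def using pow_V by blast

text \<open>The ball has radius \<open>k - 2\<close>, so its vertices and their neighbours are
  within distance \<open>k - 1\<close> of \<open>u\<close>, where \<open>M\<close> has no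
  vertex.\<close>

lemma far_from_near:
  assumes "\<And>y. y \<in> M \<Longrightarrow> \<not> near k y u" "t \<in> pball (k - 1) u" "x = t \<or> adj t x"
  shows "x \<notin> M"
proof
  assume x: "x \<in> M"
  have t: "near (k - 1) t u" using assms(2) near_sym by (auto simp: pball_def)
  from assms(3) have "near k x u"
  proof
    assume "x = t"
    then show ?thesis using near_mono[OF t, of k] by simp
  next
    assume "adj t x"
    then show ?thesis using near_adj[of x t "k - 1" u] t by (simp add: k_Suc adj_commute)
  qed
  then show False using assms(1) x by blast
qed

text \<open>Balls of radius \<open>k - 2\<close> that meet or touch have centres at most
  \<open>2k - 3\<close> apart, and this is the bound excluded by the strict
  \<open>near\<close>.\<close>

lemma far_balls_anticomplete:
  assumes "\<not> near (k - 1 + (k - 1)) u v" "t \<in> pball (k - 1) u" "t' \<in> pball (k - 1) v"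
  shows "t \<noteq> t' \<and> \<not> adj t t'"
proof (rule ccontr)
  assume neg: "\<not> ?thesis"
  have t: "near (k - 1) u t" and t': "near (k - 1) t' v"
    using assms near_sym by (auto simp: pball_def)
  have "near k t v"
    using neg near_adj[of t t' "k - 1" v] t' near_mono[OF t', of k] by (auto simp: k_Suc)
  then have "near (Suc (k - 1)) v t" using near_sym by (simp add: k_Suc)
  from near_trans[OF this near_sym[OF t]] show False using assms(1) near_sym by blast
qed

end

section \<open>Extending a claw or net in a minimal cover to a spider\<close>

locale minimal_cover = distance_cover adj V k + core_in adj D b a
  for adj :: "'a \<Rightarrow> 'a \<Rightarrow> bool" and V k D b a +
  fixes \<eta> :: "nat \<Rightarrow> 'a" and N :: nat
  assumes tailed: "tailed_cover \<eta> N D"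
    and minimal: "tailed_cover \<eta> N D' \<Longrightarrow> potential V (\<eta> 0) D \<le> potential V (\<eta> 0) D'"
begin

abbreviation "rd \<equiv> rdist D (\<eta> 0)"

lemma D_facts: "D \<subseteq> V" "covers D" "tail D \<eta> N" "\<eta> 0 \<in> D"
  using tailed by (auto simp: tailed_cover_def tail_def)

text \<open>Exchange argument: trading \<open>X j\<close> for \<open>T\<close> removes
  \<open>a j\<close> from its distance level, while \<open>nbr\<close> lets \<open>T\<close> be
  entered only beyond that level and away from the tail. The potential drops, so by minimality the
  new set cannot cover.\<close>

lemma replacement_not_covers:
  assumes j: "j < 3" and tM: "\<eta> ` {..N} \<subseteq> M j" and T: "T \<subseteq> V" "a j \<notin> T" "conn (M j \<union> T)"
    and nbr: "\<And>t x. t \<in> T \<Longrightarrow> x \<in> D \<Longrightarrow> x = t \<or> adj t x \<Longrightarrow>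
      x \<notin> \<eta> ` {..N} \<and> rd (a j) \<le> rd x"
  shows "\<not> covers (M j \<union> T)"
proof
  assume cov: "covers (M j \<union> T)"
  let ?D = "M j \<union> T"
  have r: "\<eta> 0 \<in> M j" using tM by auto
  have MD: "M j \<subseteq> D" "a j \<notin> M j" using M_sub by auto
  have "tail ?D \<eta> N"
    unfolding tail_def
  proof (intro conjI ballI impI)
    show "\<eta> ` {..N} \<subseteq> ?D" using tM by auto
    show "inj_on \<eta> {..N}" "\<forall>j<N. adj (\<eta> j) (\<eta> (Suc j))"
      using D_facts(3) unfolding tail_def by blast+
    fix i x assume i: "i \<in> {1..N}" "x \<in> ?D" "adj (\<eta> i) x"
    have "\<eta> i \<in> \<eta> ` {..N}" using i by auto
    then have "x \<notin> T" using nbr[of x "\<eta> i"] i(3) tM MD by (auto simp: adj_commute)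
    then show "x = \<eta> (i - 1) \<or> i < N \<and> x = \<eta> (Suc i)"
      using tail_nbr[OF D_facts(3), of i x] i MD by auto
  qed
  then have "tailed_cover \<eta> N ?D"
    using cov T MD D_facts(1) by (auto simp: tailed_cover_def)
  then have "potential V (\<eta> 0) D \<le> potential V (\<eta> 0) ?D" by (rule minimal)
  moreover have "potential V (\<eta> 0) ?D < potential V (\<eta> 0) D"
  proof (rule potential_less[OF finite_V D_facts(1) _ conn_D T(3) D_facts(4), where c = "a j"])
    show "?D \<subseteq> V" "\<eta> 0 \<in> ?D" "a j \<in> D" using MD D_facts(1) T r a_in[OF j] by auto
    fix x assume x: "x \<in> ?D" "rdist ?D (\<eta> 0) x \<le> rd (a j)"
    \<comment> \<open>Walks from the root with at most \<open>rd (a j)\<close> steps never enter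
      \<open>T\<close>: the vertex before the entry is at distance at least \<open>rd (a j)\<close>
      already. So they are walks in \<open>D\<close> as well.\<close>
    have "y \<in> M j \<and> (radj D ^^ n) (\<eta> 0) y" if "(radj ?D ^^ n) (\<eta> 0) y" "n \<le> rd (a j)" for n y
      using that
    proof (induction n arbitrary: y)
      case 0
      then show ?case using r by simp
    next
      case (Suc n)
      from Suc.prems(1) obtain z where z: "(radj ?D ^^ n) (\<eta> 0) z" "radj ?D z y" by (rule relpowp_Suc_E)
      then have zM: "z \<in> M j" "(radj D ^^ n) (\<eta> 0) z" using Suc.IH Suc.prems(2) by auto
      have "y \<notin> T"
      proof
        assume "y \<in> T"
        then have "rd (a j) \<le> rd z"
          using nbr[of y z] zM MD z(2) by (auto simp: radj_def adj_commute)
        then show False using rdist_le[OF zM(2)] Suc.prems(2) by simp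
      qed
      then have "y \<in> M j" "radj D z y" using z(2) zM MD by (auto simp: radj_def)
      then show ?case using relpowp_Suc_I[OF zM(2)] by blast
    qed
    from this[OF rdist_walk[OF T(3)] x(2)] x(1) r
    show "x \<in> D \<and> x \<noteq> a j \<and> rd x \<le> rdist ?D (\<eta> 0) x"
      using MD rdist_le by blast
  qed
  ultimately show False by simp
qed

lemma near_X:
  assumes "u \<in> V" "\<And>y. y \<in> M i \<Longrightarrow> \<not> near k y u"
  obtains x where "x \<in> X i" "near (Suc (k - 1)) x u"
  using assms D_facts(2) D_cases unfolding covers_def k_Suc by metis

text \<open>Induction on \<open>S\<close>. Given suitable \<open>u l\<close> for all leaves but
  \<open>j\<close>, the part \<open>X j\<close> is exchanged for the balls around these
  \<open>u l\<close>. The result does not cover, and any vertex it misses serves as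
  \<open>u j\<close>.\<close>

lemma far_uncovered_vertices:
  assumes "finite S" "S \<subseteq> {..<3}" "\<And>i. i \<in> S \<Longrightarrow> \<eta> ` {..N} \<subseteq> M i"
  shows "\<exists>u. (\<forall>i\<in>S. u i \<in> V \<and> (\<forall>y\<in>M i. \<not> near k y (u i))) \<and>
    (\<forall>i\<in>S. \<forall>l\<in>S. i \<noteq> l \<longrightarrow> \<not> near (k - 1 + (k - 1)) (u i) (u l))"
  using assms
proof (induction S rule: finite_psubset_induct)
  case (psubset S)
  show ?case
  proof (cases "S = {}")
    case False
    \<comment> \<open>\<open>j\<close> is a leaf nearest to the root, so the balls, which touch
      \<open>D\<close> only in the parts \<open>X l\<close>, attach no closer to the root than
      \<open>a j\<close>.\<close>
    let ?f = "\<lambda>l. rd (a l)"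
    have "Min (?f ` S) \<in> ?f ` S" using psubset.hyps False by (intro Min_in) auto
    then obtain j where "j \<in> S" "?f j = Min (?f ` S)" by auto
    then have j: "j \<in> S" "\<And>l. l \<in> S \<Longrightarrow> ?f j \<le> ?f l" using psubset.hyps by auto
    have j3: "j < 3" using j(1) psubset.prems(1) by auto
    obtain u where u: "\<And>i. i \<in> S - {j} \<Longrightarrow> u i \<in> V" "\<And>i y. i \<in> S - {j} \<Longrightarrow> y \<in> M i \<Longrightarrow> \<not> near k y (u i)"
      "\<And>i l. i \<in> S - {j} \<Longrightarrow> l \<in> S - {j} \<Longrightarrow> i \<noteq> l \<Longrightarrow> \<not> near (k - 1 + (k - 1)) (u i) (u l)"
    proof -
      have "S - {j} \<subset> S" "S - {j} \<subseteq> {..<3}" "\<And>i. i \<in> S - {j} \<Longrightarrow> \<eta> ` {..N} \<subseteq> M i"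
        using j psubset.prems by auto
      from psubset.IH[OF this] show thesis using that by blast
    qed
    define T where "T = (\<Union>l\<in>S - {j}. pball (k - 1) (u l))"
    have "\<not> covers (M j \<union> T)"
    proof (rule replacement_not_covers[OF j3 psubset.prems(2)[OF j(1)]])
      show "T \<subseteq> V" using near_V u(1) by (auto simp: T_def pball_def)
      show "conn (M j \<union> T)"
        unfolding T_def
      proof (rule conn_UN[OF conn_M[OF j3]])
        fix l assume l: "l \<in> S - {j}"
        obtain x where x: "x \<in> X l" "near (Suc (k - 1)) x (u l)"
          using near_X[OF u(1)[OF l] u(2)[OF l]] .
        have "x \<in> M j" using X_sub_M[OF j3, of l] l psubset.prems(1) x by auto
        then show "conn (M j \<union> pball (k - 1) (u l))"
          using conn_Un_pball(1)[OF conn_M[OF j3] _ x(2)] by blast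
      qed
      have notM: "x \<notin> M l" if "l \<in> S - {j}" "t \<in> pball (k - 1) (u l)" "x = t \<or> adj t x" for l t x
        using far_from_near[OF u(2)[OF that(1)] that(2,3)] .
      show "a j \<notin> T"
      proof
        assume "a j \<in> T"
        then obtain l where l: "l \<in> S - {j}" "a j \<in> pball (k - 1) (u l)" by (auto simp: T_def)
        moreover have "a j \<in> M l" using a_in_M[of l j] l j3 psubset.prems(1) by auto
        ultimately show False using notM by blast
      qed
      fix t x assume t: "t \<in> T" "x \<in> D" "x = t \<or> adj t x"
      then obtain l where l: "l \<in> S - {j}" "t \<in> pball (k - 1) (u l)" by (auto simp: T_def)
      have l3: "l < 3" "\<eta> ` {..N} \<subseteq> M l" using l psubset.prems by auto
      have "x \<in> X l" using notM[OF l t(3)] t(2) D_cases by blast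
      moreover from this have "rd (a l) \<le> rd x" using rdist_a_le[OF l3(1)] l3(2) by auto
      ultimately show "x \<notin> \<eta> ` {..N} \<and> rd (a j) \<le> rd x"
        using X_not_M l3(2) j(2)[of l] l by fastforce
    qed
    then obtain z where z: "z \<in> V" "\<And>d. d \<in> M j \<union> T \<Longrightarrow> \<not> near k d z" by (auto simp: covers_def)
    \<comment> \<open>Otherwise some vertex within \<open>k - 1\<close> of \<open>z\<close> is
      within \<open>k - 2\<close> of \<open>u l\<close>; it belongs to \<open>T\<close> and covers
      \<open>z\<close>.\<close>
    have zl: "\<not> near (k - 1 + (k - 1)) z (u l)" if l: "l \<in> S - {j}" for l
    proof
      assume n: "near (k - 1 + (k - 1)) z (u l)"
      then have "0 < k - 1" by (auto simp: near_def)
      from near_split[OF n this] obtain y where "near k z y" "near (k - 1) y (u l)"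
        by (auto simp: k_Suc)
      then have "y \<in> T" "near k y z" using l near_sym by (auto simp: T_def pball_def)
      then show False using z(2) by blast
    qed
    have "\<not> near (k - 1 + (k - 1)) (u l) z" if "l \<in> S - {j}" for l
      using zl[OF that] near_sym by blast
    then show ?thesis
      using u z zl by (intro exI[of _ "u(j := z)"]) auto
  qed simp
qed

text \<open>A tail vertex beyond the root has at most two neighbours in \<open>D\<close>. A branch
  vertex has three, listed by \<open>c\<close>: the leaves of a claw, or the own leaf and the other
  two branch vertices of a net.\<close>

lemma b_not_in_tail:
  assumes i: "i < 3" shows "b i \<notin> \<eta> ` {1..N}"
proof
  assume "b i \<in> \<eta> ` {1..N}"
  then obtain j where j: "1 \<le> j" "j \<le> N" "b i = \<eta> j" by auto
  define c where "c l = (if b l = b i then a l else b l)" for l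
  have "c ` {..<3} \<subseteq> {\<eta> (j - 1), \<eta> (Suc j)}"
  proof
    fix x assume "x \<in> c ` {..<3}"
    then obtain l where l: "l < 3" "x = c l" by auto
    have "adj (b i) x" "x \<in> D"
      using core_adj(1,2)[OF i l(1)] b_in a_in l by (auto simp: c_def)
    then show "x \<in> {\<eta> (j - 1), \<eta> (Suc j)}" using tail_nbr[OF D_facts(3) j(1,2)] j(3) by auto
  qed
  moreover have "inj_on c {..<3}"
  proof (rule inj_onI)
    fix l m assume lm: "l \<in> {..<3}" "m \<in> {..<3}" "c l = c m"
    then have lt: "l < 3" "m < 3" by auto
    have "(\<forall>i<3. b i = b 0) \<or> inj_on b {..<3}" using core_ba by (simp add: core_def)
    then show "l = m"
    proof
      assume "\<forall>i<3. b i = b 0"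
      then have "c l = a l" "c m = a m" using lt i by (metis c_def)+
      then show ?thesis using core_adj(4)[OF lt] lm(3) by metis
    next
      assume "inj_on b {..<3}"
      then have "b l = b m \<longleftrightarrow> l = m" "b l = b i \<longleftrightarrow> l = i" "b m = b i \<longleftrightarrow> m = i"
        using lt i by (auto dest: inj_onD)
      then show ?thesis
        using lm(3) b_ne_a[OF lt] b_ne_a[OF lt(2,1)] by (auto simp: c_def split: if_splits)
    qed
  qed
  ultimately have "card {..<3::nat} \<le> card {\<eta> (j - 1), \<eta> (Suc j)}"
    by (intro card_inj_on_le[of c]) auto
  also have "\<dots> \<le> 2" by (simp add: card_insert_if)
  finally show False by simp
qed

text \<open>As \<open>b i\<close> is off the tail beyond the root, a leaf on it can only be
  \<open>\<eta> 1\<close>. The connected set \<open>M i\<close> reaches the tail beyond the root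
  only along the edge from \<open>\<eta> 0\<close> to \<open>\<eta> 1\<close>; if both ends were in
  \<open>M i\<close>, the tail would avoid \<open>a i\<close> and lie in \<open>M i\<close>
  entirely.\<close>

lemma tail_in_X:
  assumes i: "i < 3" and nf: "\<not> \<eta> ` {..N} \<subseteq> M i"
  shows "\<eta> N \<in> X i" "a i \<in> \<eta> ` {1..N} \<Longrightarrow> a i = \<eta> 1"
proof -
  show a1: "a i = \<eta> 1" if "a i \<in> \<eta> ` {1..N}"
    using tail_exit(1)[OF D_facts(3) that b_in[OF i] b_not_in_tail[OF i]] core_adj(2)[OF i i]
    by (simp add: adj_commute)
  have out: "\<eta> 0 \<notin> M i \<or> \<eta> 1 \<notin> M i \<and> 1 \<le> N"
  proof (rule ccontr)
    assume "\<not> ?thesis"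
    then have r: "\<eta> 0 \<in> M i" and e1: "1 \<le> N \<Longrightarrow> \<eta> 1 \<in> M i" by auto
    have na: "a i \<notin> \<eta> ` {1..N}" using a1 e1 M_sub by fastforce
    have "\<eta> l \<in> M i" if "l \<le> N" for l
      using that
    proof (induction l)
      case (Suc l)
      have "\<eta> (Suc l) \<in> D" "adj (\<eta> l) (\<eta> (Suc l))"
        using D_facts(3) Suc.prems unfolding tail_def by auto
      moreover have "\<eta> (Suc l) \<noteq> a i" using na Suc.prems by (metis atLeastAtMost_iff image_eqI le_add1 plus_1_eq_Suc)
      ultimately show ?case using Suc comp_closed[of "\<eta> l" "D - {a i}" "b i" "\<eta> (Suc l)"]
        by (auto simp: M_def)
    qed (use r in simp)
    then show False using nf by auto
  qed
  have disj: "y \<notin> M i" if yt: "y \<in> \<eta> ` {1..N}" for y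
  proof
    assume "y \<in> M i"
    then obtain u v where uv: "u \<in> \<eta> ` {1..N}" "v \<notin> \<eta> ` {1..N}" "radj (M i) u v"
      using conn_cross[OF conn_M[OF i] yt _ b_in_M[OF i i] b_not_in_tail[OF i]] by metis
    then have "v \<in> D" "adj u v" using M_sub by (auto simp: radj_def)
    then have "u = \<eta> 1" "v = \<eta> 0"
      using tail_exit[OF D_facts(3) uv(1) _ uv(2)] by blast+
    then show False using out uv(3) by (auto simp: radj_def)
  qed
  have "\<eta> N \<in> D" using D_facts(3) unfolding tail_def by auto
  moreover have "\<eta> N \<notin> M i"
    using disj[of "\<eta> N"] out by (cases "N = 0") auto
  ultimately show "\<eta> N \<in> X i" by (rule D_cases)
qed

text \<open>For a leaf in \<open>S\<close>, whose \<open>M i\<close> keeps the whole tail, the leg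
  runs through \<open>X i\<close> and the ball around an uncovered \<open>u i\<close>; otherwise it
  runs inside \<open>X i\<close> to the end \<open>\<eta> N\<close> of the tail.\<close>

theorem spider_exists:
  assumes "k \<le> N \<or> k \<le> Suc N \<and> (\<forall>i<3. a i \<notin> \<eta> ` {1..N})"
  shows "\<exists>q. spider k b q"
proof -
  define S where "S = {i. i < 3 \<and> \<eta> ` {..N} \<subseteq> M i}"
  obtain u where u: "\<And>i. i \<in> S \<Longrightarrow> u i \<in> V" "\<And>i y. i \<in> S \<Longrightarrow> y \<in> M i \<Longrightarrow> \<not> near k y (u i)"
    "\<And>i l. i \<in> S \<Longrightarrow> l \<in> S \<Longrightarrow> i \<noteq> l \<Longrightarrow> \<not> near (k - 1 + (k - 1)) (u i) (u l)"
  proof -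
    have "finite S" "S \<subseteq> {..<3}" "\<And>i. i \<in> S \<Longrightarrow> \<eta> ` {..N} \<subseteq> M i" by (auto simp: S_def)
    from far_uncovered_vertices[OF this] show thesis using that by blast
  qed
  define B where "B i = (if i \<in> S then pball (k - 1) (u i) else {})" for i
  define e where "e i = (if i \<in> S then u i else \<eta> N)" for i
  have BM: "x \<notin> M i" if "t \<in> B i" "x = t \<or> adj t x" for i t x
    using far_from_near[of "M i" "u i" t x] u(2)[of i] that by (auto simp: B_def split: if_splits)
  have base: "conn (X i \<union> B i) \<and> e i \<in> X i \<union> B i" if i: "i < 3" for i
  proof (cases "i \<in> S")
    case True
    obtain x where x: "x \<in> X i" "near (Suc (k - 1)) x (u i)"
      using near_X[OF u(1)[OF True] u(2)[OF True]] .
    then show ?thesis using conn_Un_pball[OF conn_X[OF i] x] True by (simp add: B_def e_def)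
  next
    case False
    then show ?thesis using tail_in_X(1)[OF i] conn_X[OF i] i by (auto simp: B_def e_def S_def)
  qed
  show ?thesis
  proof (rule spider_of_legs[OF core_ba k_pos, of "\<lambda>i. X i \<union> B i" e])
    fix i :: nat assume i: "i < 3"
    show "conn (X i \<union> B i)" "e i \<in> X i \<union> B i" using base[OF i] by auto
    show "a i \<in> X i \<union> B i" using a_in_X[OF i] by simp
    fix n assume w: "(radj (X i \<union> B i) ^^ n) (a i) (e i)"
    have ba: "adj (b i) (a i)" using core_adj(2)[OF i i] by simp
    show "k \<le> Suc n"
    \<comment> \<open>For \<open>i \<in> S\<close>, \<open>b i\<close> lies in \<open>M i\<close>
      and does not cover \<open>u i\<close>, so the walk extended to \<open>b i\<close> has at least
      \<open>k\<close> steps. In the other case the extended walk has at least \<open>N\<close>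
      steps, and already the walk from \<open>a i\<close> has if \<open>a i\<close> is off the tail:
      this is why the assumption has two alternatives.\<close>
    proof (cases "i \<in> S")
      case True
      have "(adj ^^ Suc n) (b i) (u i)"
        using relpowp_Suc_I2[OF ba radj_pow_adj[OF w]] True by (simp add: e_def)
      then show ?thesis using u(2)[OF True b_in_M[OF i i]] unfolding near_def
        by (metis not_le_imp_less)
    next
      case False
      have w': "(radj D ^^ n) (a i) (\<eta> N)"
        using radj_pow_mono[OF w, of D] X_sub False by (auto simp: B_def e_def)
      moreover have "radj D (b i) (a i)" using ba b_in a_in i by (simp add: radj_def)
      ultimately have "(radj D ^^ Suc n) (b i) (\<eta> N)" by (rule relpowp_Suc_I2[rotated])
      from tail_walk_length[OF D_facts(3) b_not_in_tail[OF i] this]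
      have "N \<le> Suc n" by simp
      moreover have "N \<le> n" if "a i \<notin> \<eta> ` {1..N}"
        using tail_walk_length[OF D_facts(3) that w'] by simp
      ultimately show ?thesis using assms i by fastforce
    qed
  next
    fix i j :: nat and x y assume ij: "i < 3" "j < 3" "i \<noteq> j" and xy: "x \<in> X i \<union> B i" "y \<in> X j \<union> B j"
    show "x \<noteq> y \<and> \<not> adj x y"
    proof (cases "x \<in> B i")
      case xB: True
      show ?thesis
      proof (cases "y \<in> B j")
        case True
        then have "i \<in> S" "j \<in> S" "x \<in> pball (k - 1) (u i)" "y \<in> pball (k - 1) (u j)"
          using xB by (auto simp: B_def split: if_splits)
        then show ?thesis using far_balls_anticomplete[OF u(3)] ij by blast
      next
        case False
        then have "y \<in> M i" using xy X_sub_M[OF ij] by auto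
        then show ?thesis using BM[OF xB, of y] by blast
      qed
    next
      case False
      then have x: "x \<in> X i" "x \<in> M j" using xy X_sub_M[of j i] ij by auto
      show ?thesis
      proof (cases "y \<in> B j")
        case True
        then show ?thesis using BM[OF True, of x] x by (auto simp: adj_commute)
      next
        case False
        then show ?thesis using X_anticomplete[OF ij x(1)] xy by blast
      qed
    qed
  next
    fix i j :: nat and x assume ij: "i < 3" "j < 3" and x: "x \<in> X i \<union> B i"
    have bM: "b j \<in> M i" using b_in_M[OF ij] .
    show "b j \<noteq> x \<and> (adj (b j) x \<longrightarrow> x = a i)"
    proof (cases "x \<in> B i")
      case True
      then show ?thesis using BM[OF True, of "b j"] bM by (auto simp: adj_commute)
    next
      case False
      then show ?thesis using x X_M_adj[OF _ bM] X_not_M bM by blast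
    qed
  qed
qed

end

section \<open>Covering paths\<close>

context distance_cover
begin

text \<open>Identifies distances measured inside \<open>V\<close> with those counted by
  \<open>near\<close>.\<close>

lemma adj_eq_radj: "adj = radj V"
proof (intro ext)
  show "adj x y = radj V x y" for x y
    using adj_V[of x y] adj_V[of y x] adj_commute[of x y] by (auto simp: radj_def)
qed

lemma covers_mono: "covers D \<Longrightarrow> D \<subseteq> E \<Longrightarrow> covers E"
  unfolding covers_def by blast

lemma minimal_tailed_cover:
  assumes "tailed_cover \<eta> N D0"
  obtains D where "tailed_cover \<eta> N D"
    "\<And>D'. tailed_cover \<eta> N D' \<Longrightarrow> potential V (\<eta> 0) D \<le> potential V (\<eta> 0) D'"
  using ex_has_least_nat[of "tailed_cover \<eta> N" D0 "potential V (\<eta> 0)"] assms by blast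

text \<open>A core in \<open>E\<close> is a core in the minimal cover \<open>D\<close>. If
  \<open>E\<close> avoids the tail beyond its root, so do the leaves, and a tail of length
  \<open>k - 1\<close> suffices.\<close>

lemma core_free_minimal_cover:
  assumes "tailed_cover \<eta> N D"
    and "\<And>D'. tailed_cover \<eta> N D' \<Longrightarrow> potential V (\<eta> 0) D \<le> potential V (\<eta> 0) D'"
    and "E \<subseteq> D" "k \<le> N \<or> k \<le> Suc N \<and> E \<inter> \<eta> ` {1..N} = {}"
    and "\<nexists>b q. spider k b q"
  shows "core_free E"
  unfolding core_free_def
proof (intro notI, elim exE conjE)
  fix b a assume ba: "core b a" "\<forall>i<3. b i \<in> E \<and> a i \<in> E"
  interpret minimal_cover adj V k D b a \<eta> N
    by unfold_locales (use assms(1-3) ba in \<open>auto simp: tailed_cover_def\<close>)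
  have "k \<le> N \<or> k \<le> Suc N \<and> (\<forall>i<3. a i \<notin> \<eta> ` {1..N})" using assms(4) ba by blast
  from spider_exists[OF this] assms(5) show False by blast
qed

lemma conn_path:
  assumes "\<And>i. i < n \<Longrightarrow> adj (f i) (f (Suc i))"
  shows "conn (f ` {..n::nat})"
  using assms
proof (induction n)
  case (Suc n)
  have "conn (insert (f (Suc n)) (f ` {..n}))"
    by (rule conn_insert[of _ "f n"]) (use Suc in \<open>auto simp: adj_commute\<close>)
  then show ?case by (simp add: atMost_Suc)
qed (simp add: atMost_0)

text \<open>In a smallest connected cover, which is no singleton since singletons are traceable,
  deleting a non-cut vertex \<open>v\<close> uncovers some \<open>e\<close>. A shortest path from
  \<open>v\<close> to \<open>e\<close> becomes the tail.\<close>

lemma first_tailed_cover: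
  assumes "\<nexists>D. traceable D \<and> D \<noteq> {} \<and> D \<subseteq> V \<and> covers D"
  obtains \<eta> N D where "tailed_cover \<eta> N D" "k = Suc N"
proof -
  define P where "P D \<longleftrightarrow> conn D \<and> D \<subseteq> V \<and> covers D" for D
  have "near k z z" for z using near_refl[of "k - 1"] by (simp add: k_Suc)
  then have "P V" using conn_V by (auto simp: P_def covers_def)
  then obtain D where D: "P D" "\<And>D'. P D' \<Longrightarrow> card D \<le> card D'"
    using ex_has_least_nat[of P V card] by blast
  have finD: "finite D" using D(1) finite_V finite_subset by (auto simp: P_def)
  have "D \<noteq> {x}" for x
  proof
    assume x: "D = {x}"
    have "traceable {x}" by (rule traceableI[of "[x]"]) auto
    then show False using assms D(1) x by (auto simp: P_def)
  qed
  then obtain v where v: "v \<in> D" "conn (D - {v})"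
    using noncut_exists[OF finD] D(1) by (auto simp: P_def)
  have "\<not> P (D - {v})" using D(2)[of "D - {v}"] finD v(1) by (auto dest: card_Diff1_less)
  then obtain e where e: "e \<in> V" "\<And>d. d \<in> D - {v} \<Longrightarrow> \<not> near k d e"
    using v(2) D(1) by (auto simp: P_def covers_def)
  have vV: "v \<in> V" and ve: "near k v e" using D(1) v(1) e by (auto simp: P_def covers_def)
  define n where "n = rdist V v e"
  obtain f where f: "f 0 = v" "f n = e" "\<And>i. i < n \<Longrightarrow> adj (f i) (f (Suc i))"
    "\<And>i. i \<le> n \<Longrightarrow> f i \<in> V" "\<And>i. i \<le> n \<Longrightarrow> (adj ^^ (n - i)) (f i) e" "inj_on f {..n}"
    "\<And>i j. i \<le> n \<Longrightarrow> j \<le> n \<Longrightarrow> adj (f i) (f j) \<Longrightarrow> i = Suc j \<or> j = Suc i"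
    using geodesic[OF conn_V vV e(1)] unfolding n_def adj_eq_radj[symmetric] by metis
  have nk: "n < k"
    using ve rdist_le[where D = V] unfolding near_def n_def adj_eq_radj[symmetric]
    by (meson le_less_trans)
  \<comment> \<open>A neighbour of \<open>f i\<close> in the rest of the cover reaches
    \<open>e\<close> in \<open>n - i + 1\<close> steps, yet must not cover it.\<close>
  have clash: "k \<le> Suc (n - i)" if "d \<in> D - {v}" "adj d (f i)" "i \<le> n" for d i
    using relpowp_Suc_I2[OF that(2) f(5)[OF that(3)]] e(2)[OF that(1)] unfolding near_def
    by (meson not_le_imp_less)
  obtain d where "d \<in> D - {v}" using v(2) by (auto simp: conn_def)
  then obtain y where y: "y \<in> D - {v}" "adj y v"
    using conn_cross[of D v "{v}" d] D(1) v(1) by (auto simp: P_def radj_def adj_commute)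
  \<comment> \<open>For a neighbour of \<open>v = f 0\<close> the clash gives
    \<open>k \<le> Suc n\<close>, so the path has exactly \<open>k - 1\<close> edges. For
    \<open>i \<ge> 1\<close> the clash then leaves no neighbours in the rest of the cover.\<close>
  have kn: "k = Suc n" using clash[of y 0] y f(1) nk by simp
  have "tail (D \<union> f ` {..n}) f n"
    unfolding tail_def
  proof (intro conjI ballI impI)
    fix j x assume j: "j \<in> {1..n}" "x \<in> D \<union> f ` {..n}" "adj (f j) x"
    have "x \<in> f ` {..n}"
      using clash[of x j] j kn f(1) by (cases "x = v") (auto simp: adj_commute)
    then obtain i where i: "i \<le> n" "x = f i" by auto
    then have "j = Suc i \<or> i = Suc j" using f(7)[of j i] j by auto
    then show "x = f (j - 1) \<or> j < n \<and> x = f (Suc j)" using i by auto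
  qed (use f in auto)
  moreover have "conn (D \<union> f ` {..n})"
    by (rule conn_Un[OF _ conn_path[of n f], of _ v "f 0"]) (use D(1) v(1) f in \<open>auto simp: P_def\<close>)
  ultimately have "tailed_cover f n (D \<union> f ` {..n})"
    using D(1) f(4) covers_mono[of D] by (auto simp: tailed_cover_def P_def)
  then show thesis using that kn by blast
qed

text \<open>Among the vertices not covered by \<open>W\<close>, take \<open>z\<close> whose first
  covering tail vertex \<open>\<eta> J\<close> is as far along as possible. The tail is cut at
  \<open>\<eta> J\<close> and continued by a geodesic to \<open>z\<close>; what \<open>W\<close>
  misses is still covered by \<open>\<eta> 1\<close>, ..., \<open>\<eta> J\<close>.\<close>

lemma longer_tailed_cover:
  assumes D: "tailed_cover \<eta> N D" and kN: "k = Suc N" and "\<not> covers (D - \<eta> ` {1..N})"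
  obtains \<eta>' N' D' where "tailed_cover \<eta>' N' D'" "k \<le> N'"
proof -
  define W where "W = D - \<eta> ` {1..N}"
  have tail: "tail D \<eta> N" and DV: "D \<subseteq> V" and cov: "covers D" and conD: "conn D"
    using D by (auto simp: tailed_cover_def)
  have W: "conn W" "\<eta> 0 \<in> W" using conn_remove_tail[OF conD tail] by (auto simp: W_def)
  define Z where "Z = {z \<in> V. \<forall>d\<in>W. \<not> near k d z}"
  define lv where "lv z = (LEAST j. near k (\<eta> j) z)" for z
  have lv: "near k (\<eta> (lv z)) z" "lv z \<le> N" "lv z \<noteq> 0" if z: "z \<in> Z" for z
  proof -
    obtain d where d: "d \<in> D" "near k d z" using cov z by (auto simp: covers_def Z_def)
    then have "d \<in> \<eta> ` {1..N}" using z by (auto simp: Z_def W_def)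
    then obtain j where j: "j \<le> N" "near k (\<eta> j) z" using d by auto
    show l: "near k (\<eta> (lv z)) z" unfolding lv_def by (rule LeastI[of "\<lambda>j. near k (\<eta> j) z", OF j(2)])
    have "lv z \<le> j" unfolding lv_def by (rule Least_le[of "\<lambda>j. near k (\<eta> j) z", OF j(2)])
    then show "lv z \<le> N" using j by simp
    show "lv z \<noteq> 0" using l W(2) z unfolding Z_def by (metis (no_types, lifting) mem_Collect_eq)
  qed
  obtain z0 where "z0 \<in> Z" using assms(3) by (auto simp: covers_def Z_def W_def)
  then obtain z where z: "z \<in> Z" and zmax: "\<And>z'. z' \<in> Z \<Longrightarrow> lv z' \<le> lv z"
    using ex_has_greatest_nat[of "\<lambda>z. z \<in> Z" z0 lv "Suc N"] lv(2) by (metis le_imp_less_Suc)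
  define J where "J = lv z"
  have J: "near k (\<eta> J) z" "J \<le> N" "1 \<le> J" using lv[OF z] by (auto simp: J_def)
  have below: "\<not> near k (\<eta> i) z" if "i < J" for i using that not_less_Least by (auto simp: J_def lv_def)
  have \<eta>V: "\<eta> i \<in> V" "\<eta> i \<in> D" if "i \<le> N" for i using that tail DV by (auto simp: tail_def)
  have zV: "z \<in> V" using z by (simp add: Z_def)
  define m where "m = rdist V (\<eta> J) z"
  obtain f where f: "f 0 = \<eta> J" "f m = z" "\<And>i. i < m \<Longrightarrow> adj (f i) (f (Suc i))"
    "\<And>i. i \<le> m \<Longrightarrow> f i \<in> V" "\<And>i. i \<le> m \<Longrightarrow> (adj ^^ (m - i)) (f i) z" "inj_on f {..m}"
    "\<And>i j. i \<le> m \<Longrightarrow> j \<le> m \<Longrightarrow> adj (f i) (f j) \<Longrightarrow> i = Suc j \<or> j = Suc i"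
    using geodesic[OF conn_V \<eta>V(1)[OF J(2)] zV] unfolding m_def adj_eq_radj[symmetric] by metis
  have mk: "m < k"
    using J(1) rdist_le[where D = V] unfolding near_def m_def adj_eq_radj[symmetric]
    by (meson le_less_trans)
  \<comment> \<open>Everything on or next to the geodesic beyond its start covers \<open>z\<close>.
    Neither \<open>W\<close> nor \<open>\<eta> i\<close> with \<open>i < J\<close> does, so the new
    part of the tail stays clear of both.\<close>
  have fz: "near k x z" if "1 \<le> i" "i \<le> m" "x = f i \<or> adj x (f i)" for x i
  proof -
    have "near (m - i + 1) (f i) z" using f(5)[OF that(2)] by (auto simp: near_def)
    moreover from this have "near (m - i + 2) x z" if "adj x (f i)"
      using near_adj[OF that] by fastforce
    ultimately show ?thesis
      using that(3) near_mono[of "m - i + 1" x z k] near_mono[of "m - i + 2" x z k] that mk by auto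
  qed
  have \<eta>adj: "adj (\<eta> i) (\<eta> (Suc i))" if "i < N" for i using tail that by (auto simp: tail_def)
  \<comment> \<open>If \<open>z\<close> were closer than \<open>k - 1\<close> to
    \<open>\<eta> J\<close>, then \<open>\<eta> (J - 1)\<close> would cover it too. Together with
    \<open>1 \<le> J\<close> this makes the new tail at least \<open>k\<close> long.\<close>
  have km: "k = Suc m"
  proof (rule ccontr)
    assume "k \<noteq> Suc m"
    have "adj (\<eta> (J - 1)) (\<eta> J)" using \<eta>adj[of "J - 1"] J by auto
    moreover have "near (Suc m) (\<eta> J) z" using f(5)[of 0] f(1) by (auto simp: near_def)
    ultimately have "near (Suc (Suc m)) (\<eta> (J - 1)) z" by (rule near_adj)
    then have "near k (\<eta> (J - 1)) z" using near_mono mk \<open>k \<noteq> Suc m\<close> by simp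
    then show False using below[of "J - 1"] J by simp
  qed
  define \<eta>' where "\<eta>' i = (if i \<le> J then \<eta> i else f (i - J))" for i
  define N' where "N' = J + m"
  define D' where "D' = W \<union> \<eta>' ` {..N'}"
  have hi: "\<eta>' i = f (i - J)" if "J \<le> i" for i using that f(1) by (auto simp: \<eta>'_def)
  have adj': "adj (\<eta>' i) (\<eta>' (Suc i))" if "i < N'" for i
  proof (cases "i < J")
    case True
    then show ?thesis using \<eta>adj[of i] J by (simp add: \<eta>'_def)
  next
    case False
    then show ?thesis using hi[of i] hi[of "Suc i"] f(3)[of "i - J"] that
      by (simp add: N'_def Suc_diff_le)
  qed
  have ordered: "\<eta>' i \<noteq> \<eta>' j \<and> (adj (\<eta>' i) (\<eta>' j) \<longrightarrow> j = Suc i)" if ij: "i < j" "j \<le> N'" for i j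
  proof -
    consider "j \<le> J" | "J \<le> i" | "i < J" "J < j" by linarith
    then show ?thesis
    proof cases
      case 1
      have inj: "\<eta> l = \<eta> l' \<longleftrightarrow> l = l'" if "l \<le> N" "l' \<le> N" for l l'
        using tail that by (auto simp: tail_def dest: inj_onD)
      have "j = Suc i" if "adj (\<eta> i) (\<eta> j)"
        using tail_nbr[OF tail, of j "\<eta> i"] that 1 ij J inj[of i "j - 1"] inj[of i "Suc j"] \<eta>V(2)[of i]
        by (auto simp: adj_commute)
      then show ?thesis using inj[of i j] 1 ij J by (auto simp: \<eta>'_def)
    next
      case 2
      then have le: "i - J \<le> m" "j - J \<le> m" "i - J < j - J" using ij by (auto simp: N'_def)
      have "f (i - J) \<noteq> f (j - J)" using inj_onD[OF f(6), of "i - J" "j - J"] le by auto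
      moreover have "j = Suc i" if "adj (f (i - J)) (f (j - J))"
        using f(7)[OF le(1,2) that] le(3) 2 by auto
      ultimately show ?thesis using hi[of i] hi[of j] 2 ij by simp
    next
      case 3
      have "\<not> near k (\<eta>' i) z" using below 3 by (simp add: \<eta>'_def)
      moreover have "1 \<le> j - J" "j - J \<le> m" using 3 ij by (auto simp: N'_def)
      ultimately show ?thesis using fz[of "j - J" "\<eta>' i"] hi[of j] 3 by auto
    qed
  qed
  have "tail D' \<eta>' N'"
    unfolding tail_def
  proof (intro conjI ballI impI)
    show "\<eta>' ` {..N'} \<subseteq> D'" by (simp add: D'_def)
    show "inj_on \<eta>' {..N'}"
      by (rule linorder_inj_onI) (use ordered in auto)
    show "\<forall>j<N'. adj (\<eta>' j) (\<eta>' (Suc j))" using adj' by blast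
    fix j x assume j: "j \<in> {1..N'}" "x \<in> D'" "adj (\<eta>' j) x"
    show "x = \<eta>' (j - 1) \<or> j < N' \<and> x = \<eta>' (Suc j)"
    proof (cases "x \<in> W")
      case True
      have "j \<le> J"
      proof (rule ccontr)
        assume "\<not> j \<le> J"
        then have "near k x z" using fz[of "j - J" x] hi[of j] j by (auto simp: N'_def adj_commute)
        then show False using z True by (auto simp: Z_def)
      qed
      then have "\<eta>' j = \<eta> j" "\<eta> j \<in> \<eta> ` {1..N}" "\<eta>' (j - 1) = \<eta> (j - 1)" using j J by (auto simp: \<eta>'_def)
      moreover have "x \<noteq> \<eta> (Suc j)" if "j < N" using True that by (auto simp: W_def)
      ultimately show ?thesis using tail_nbr[OF tail, of j x] j \<open>j \<le> J\<close> J True by (auto simp: W_def)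
    next
      case False
      then obtain i where i: "i \<le> N'" "x = \<eta>' i" using j by (auto simp: D'_def)
      then have "i \<noteq> j" using j by auto
      then have "j = Suc i \<or> i = Suc j"
        using ordered[of i j] ordered[of j i] i j adj_commute[of "\<eta>' i" "\<eta>' j"]
        by (cases i j rule: linorder_cases) auto
      then show ?thesis using i by auto
    qed
  qed
  moreover have "conn D'"
    unfolding D'_def
    by (rule conn_Un[OF W(1) conn_path[of N' \<eta>'], of "\<eta> 0" "\<eta>' 0"]) (use adj' W(2) in \<open>auto simp: \<eta>'_def\<close>)
  moreover have "D' \<subseteq> V"
    using DV \<eta>V(1) J f(4) by (auto simp: D'_def W_def \<eta>'_def N'_def)
  moreover have "covers D'"
    unfolding covers_def
  proof
    fix y assume y: "y \<in> V"
    show "\<exists>d\<in>D'. near k d y"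
    proof (cases "y \<in> Z")
      case True
      have "lv y \<le> J" using zmax[OF True] by (simp add: J_def)
      then have "\<eta> (lv y) = \<eta>' (lv y)" "lv y \<le> N'" by (auto simp: \<eta>'_def N'_def)
      then show ?thesis using lv(1)[OF True] by (auto simp: D'_def)
    next
      case False
      then show ?thesis using y by (auto simp: Z_def D'_def)
    qed
  qed
  ultimately have "tailed_cover \<eta>' N' D'" by (simp add: tailed_cover_def)
  moreover have "k \<le> N'" using km J by (simp add: N'_def)
  ultimately show thesis using that by blast
qed

theorem traceable_cover:
  assumes "\<nexists>b q. spider k b q"
  shows "\<exists>D. traceable D \<and> D \<noteq> {} \<and> D \<subseteq> V \<and> covers D"
proof (rule ccontr)
  assume none: "\<nexists>D. traceable D \<and> D \<noteq> {} \<and> D \<subseteq> V \<and> covers D"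
  obtain \<eta> N D0 where "tailed_cover \<eta> N D0" and kN: "k = Suc N"
    using first_tailed_cover[OF none] .
  then obtain D where D: "tailed_cover \<eta> N D"
    "\<And>D'. tailed_cover \<eta> N D' \<Longrightarrow> potential V (\<eta> 0) D \<le> potential V (\<eta> 0) D'"
    using minimal_tailed_cover by blast
  let ?W = "D - \<eta> ` {1..N}"
  \<comment> \<open>The tail has only \<open>k - 1\<close> edges here, so only cores off the tail
    beyond its root are excluded.\<close>
  have "core_free ?W"
    by (rule core_free_minimal_cover[OF D _ _ assms]) (use kN in auto)
  moreover have W: "conn ?W" "?W \<subseteq> V"
    using D(1) conn_remove_tail(1)[of D \<eta> N] by (auto simp: tailed_cover_def)
  moreover from W have "finite ?W" using finite_V finite_subset by blast
  ultimately have "traceable ?W" by (intro core_free_traceable)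
  then have "\<not> covers ?W" using none W by (auto simp: conn_def)
  then obtain \<eta>' N' D1 where "tailed_cover \<eta>' N' D1" and kN': "k \<le> N'"
    using longer_tailed_cover[OF D(1) kN] by blast
  then obtain D' where D': "tailed_cover \<eta>' N' D'"
    "\<And>D''. tailed_cover \<eta>' N' D'' \<Longrightarrow> potential V (\<eta>' 0) D' \<le> potential V (\<eta>' 0) D''"
    using minimal_tailed_cover by blast
  \<comment> \<open>With a tail of length at least \<open>k\<close>, cores that use the tail are
    excluded as well.\<close>
  have "core_free D'"
    by (rule core_free_minimal_cover[OF D' _ _ assms]) (use kN' in auto)
  moreover have W': "conn D'" "D' \<subseteq> V" "covers D'" using D'(1) by (auto simp: tailed_cover_def)
  moreover from W' have "finite D'" using finite_V finite_subset by blast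
  ultimately have "traceable D'" by (intro core_free_traceable)
  then show False using none W' by (auto simp: conn_def)
qed

end

section \<open>Subdivided claws and nets\<close>

lemma in_symcl_iff: "(x, y) \<in> symcl R \<longleftrightarrow> (x, y) \<in> R \<or> (y, x) \<in> R"
  by (auto simp: symcl_def)

text \<open>Level \<open>0\<close> holds the centre alone, so arcs between levels \<open>0\<close>
  and \<open>1\<close> put no condition on the leg indices.\<close>

lemma subdivided_claw_arc_iff:
  assumes "(i, j) \<in> pverts (subdivided_claw k)" "(i', j') \<in> pverts (subdivided_claw k)"
  shows "((i, j), (i', j')) \<in> parcs (subdivided_claw k) \<longleftrightarrow>
    j = 0 \<and> j' = 1 \<or> j = 1 \<and> j' = 0 \<or> i = i' \<and> 0 < j \<and> 0 < j' \<and> (j = Suc j' \<or> j' = Suc j)"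
proof -
  let ?R = "{(if j = 0 then (0, 0) else (i, j), (i, Suc j)) | i j. i < 3 \<and> j < k}"
  have R: "((i, j), (i', j')) \<in> ?R \<longleftrightarrow> i' < 3 \<and> j < k \<and> j' = Suc j \<and> (i, j) = (if j = 0 then (0, 0) else (i', j))"
    for i j i' j' :: nat
    by force
  have ver: "i < 3" "j \<le> k" "j = 0 \<longrightarrow> i = 0" "i' < 3" "j' \<le> k" "j' = 0 \<longrightarrow> i' = 0"
    using assms by (auto simp: subdivided_claw_def)
  have "((i, j), (i', j')) \<in> parcs (subdivided_claw k) \<longleftrightarrow>
      ((i, j), (i', j')) \<in> ?R \<or> ((i', j'), (i, j)) \<in> ?R"
    unfolding subdivided_claw_def by (simp only: pair_pre_digraph.simps in_symcl_iff)
  then show ?thesis unfolding R using ver by auto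
qed

lemma subdivided_net_arc_iff:
  assumes "(i, j) \<in> pverts (subdivided_net k)" "(i', j') \<in> pverts (subdivided_net k)"
  shows "((i, j), (i', j')) \<in> parcs (subdivided_net k) \<longleftrightarrow>
    j = 0 \<and> j' = 0 \<and> i \<noteq> i' \<or> i = i' \<and> (j = Suc j' \<or> j' = Suc j)"
proof -
  have "i < 3" "j \<le> k" "i' < 3" "j' \<le> k" using assms by (auto simp: subdivided_net_def)
  then show ?thesis unfolding subdivided_net_def
    by (simp only: pair_pre_digraph.simps in_symcl_iff) auto
qed

section \<open>Spiders have no covering path and are the copies of the two subdivided graphs\<close>

context sym_graph
begin

lemma spider_no_covering_path:
  assumes spider: "spider k b q" and k: "1 \<le> k"
    and V: "V = b ` {..<3} \<union> {q i j | i j. i < 3 \<and> j < k}"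
    and adj_V: "\<And>x y. adj x y \<Longrightarrow> y \<in> V"
    and p: "distinct p" "successively adj p" "set p \<subseteq> V"
  shows "\<exists>v\<in>V. \<forall>u\<in>set p. \<not> near k u v"
proof (rule ccontr)
  assume neg: "\<not> ?thesis"
  define L where "L i = q i ` {..<k}" for i
  have bb: "adj (b i) (q i' j) \<longleftrightarrow> j = 0 \<and> b i = b i'" "b i \<noteq> q i' j" if "i < 3" "i' < 3" "j < k" for i i' j
    using spider that unfolding spider_def by blast+
  have qq: "adj (q i j) (q i' j') \<longleftrightarrow> i = i' \<and> (j = Suc j' \<or> j' = Suc j)"
    "q i j = q i' j' \<longleftrightarrow> i = i' \<and> j = j'"
    if "i < 3" "i' < 3" "j < k" "j' < k" for i i' j j'
    using spider that unfolding spider_def by blast+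
  \<comment> \<open>Each step lowers the index on the leg by at most one, and the branch vertex is
    \<open>k\<close> steps from the leaf, so fewer than \<open>k\<close> steps do not leave the
    leg.\<close>
  have stay: "\<exists>j<k. u = q i j \<and> k \<le> Suc (j + n)"
    if "i < 3" "(adj ^^ n) (q i (k - 1)) u" "n < k" for i n u
    using that
  proof (induction n arbitrary: u)
    case 0
    then show ?case using k by (intro exI[of _ "k - 1"]) auto
  next
    case (Suc n)
    from Suc.prems(2) obtain w where w: "(adj ^^ n) (q i (k - 1)) w" "adj w u" by (rule relpowp_Suc_E)
    then obtain j where j: "j < k" "w = q i j" "k \<le> Suc (j + n)" using Suc.IH Suc.prems by auto
    have "u \<in> V" using adj_V w(2) .
    then consider i' where "i' < 3" "u = b i'" | i' j' where "i' < 3" "j' < k" "u = q i' j'"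
      unfolding V by auto
    then show ?case
    proof cases
      case 1
      then show ?thesis using bb(1)[OF 1(1) Suc.prems(1) j(1)] w(2) j Suc.prems(3)
        by (auto simp: adj_commute)
    next
      case 2
      then show ?thesis using qq(1)[OF Suc.prems(1) 2(1) j(1) 2(2)] w(2) j by auto
    qed
  qed
  have meets: "\<exists>n<length p. p ! n \<in> L i" if i: "i < 3" for i
  proof -
    have "k - 1 < k" using k by simp
    then have "q i (k - 1) \<in> V" using i unfolding V by blast
    then obtain u where u: "u \<in> set p" "near k u (q i (k - 1))" using neg by blast
    then obtain m where "m < k" "(adj ^^ m) (q i (k - 1)) u"
      using near_sym[OF u(2)] by (auto simp: near_def)
    then have "u \<in> L i" using stay[OF i] by (auto simp: L_def)
    then show ?thesis using u(1) by (metis in_set_conv_nth)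
  qed
  have exit: "y = b i" if xy: "i < 3" "x \<in> L i" "y \<notin> L i" "adj x y" for i x y
  proof -
    obtain j where j: "j < k" "x = q i j" using xy(2) by (auto simp: L_def)
    have "y \<in> V" using adj_V xy(4) .
    then consider i' where "i' < 3" "y = b i'" | i' j' where "i' < 3" "j' < k" "y = q i' j'"
      unfolding V by auto
    then show ?thesis
    proof cases
      case 1
      then show ?thesis using bb(1)[OF 1(1) xy(1) j(1)] xy(4) j by (simp add: adj_commute)
    next
      case 2
      then show ?thesis using qq(1)[OF xy(1) 2(1) j(1) 2(2)] xy(3,4) j by (auto simp: L_def)
    qed
  qed
  have bL: "b i \<notin> L i" if "i < 3" for i using bb(2)[OF that that] by (auto simp: L_def)
  have disj: "x \<notin> L i'" if "x \<in> L i" "i < 3" "i' < 3" "i \<noteq> i'" for x i i'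
    using that qq(2)[OF that(2,3)] by (auto simp: L_def)
  have step: "adj (p ! n) (p ! Suc n)" if "Suc n < length p" for n
    using p(2) that by (simp add: successively_conv_nth)
  \<comment> \<open>The vertices just before entering and just after leaving the leg are both
    \<open>b i\<close>, at two different positions of a path.\<close>
  have middle: False
    if ord: "n1 < n2" "n2 < n3" "n3 < length p" "i < 3" "p ! n1 \<notin> L i" "p ! n2 \<in> L i" "p ! n3 \<notin> L i"
    for n1 n2 n3 i
  proof -
    obtain l where l: "n1 \<le> l" "l < n2" "p ! l \<notin> L i" "p ! Suc l \<in> L i"
      using crossing_index[of n1 n2 "\<lambda>n. p ! n \<notin> L i"] ord by metis
    obtain m where m: "n2 \<le> m" "m < n3" "p ! m \<in> L i" "p ! Suc m \<notin> L i"
      using crossing_index[of n2 n3 "\<lambda>n. p ! n \<in> L i"] ord by metis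
    have "p ! l = b i"
      using exit[OF ord(4) l(4,3)] step[of l] l m ord by (auto simp: adj_commute)
    moreover have "p ! Suc m = b i"
      using exit[OF ord(4) m(3,4)] step[of m] m ord by auto
    moreover have "l < length p" "Suc m < length p" "l \<noteq> Suc m" using l m ord by auto
    ultimately show False using p(1) by (metis nth_eq_iff_index_eq)
  qed
  obtain n where n: "\<And>i. i < 3 \<Longrightarrow> n i < length p \<and> p ! n i \<in> L i" using meets by metis
  have ne: "n i \<noteq> n i'" if "i < 3" "i' < 3" "i \<noteq> i'" for i i'
    using n[OF that(1)] n[OF that(2)] disj[of "p ! n i" i i'] that by metis
  have no: False if "i < 3" "j < 3" "l < 3" "n i < n j" "n j < n l" for i j l
  proof -
    have "i \<noteq> j" "l \<noteq> j" using that by auto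
    then show False
      using middle[of "n i" "n j" "n l" j] that n[OF that(1)] n[OF that(2)] n[OF that(3)]
        disj[of "p ! n i" i j] disj[of "p ! n l" l j] by blast
  qed
  have "n 0 \<noteq> n 1" "n 0 \<noteq> n 2" "n 1 \<noteq> n 2" by (rule ne; simp)+
  moreover have "\<not> (n 0 < n 1 \<and> n 1 < n 2)" "\<not> (n 0 < n 2 \<and> n 2 < n 1)" "\<not> (n 1 < n 0 \<and> n 0 < n 2)"
    "\<not> (n 1 < n 2 \<and> n 2 < n 0)" "\<not> (n 2 < n 0 \<and> n 0 < n 1)" "\<not> (n 2 < n 1 \<and> n 1 < n 0)"
    using no[of 0 1 2] no[of 0 2 1] no[of 1 0 2] no[of 1 2 0] no[of 2 0 1] no[of 2 1 0] by auto
  ultimately show False by linarith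
qed

definition embeds :: "(nat \<times> nat) pair_pre_digraph \<Rightarrow> (nat \<times> nat \<Rightarrow> 'a) \<Rightarrow> bool" where
  "embeds F \<phi> \<longleftrightarrow> inj_on \<phi> (pverts F) \<and>
    (\<forall>x\<in>pverts F. \<forall>y\<in>pverts F. adj (\<phi> x) (\<phi> y) \<longleftrightarrow> (x, y) \<in> parcs F)"

lemma spider_imp_embeds:
  assumes "spider k b q"
  shows "\<exists>\<phi>. embeds (subdivided_claw k) \<phi> \<or> embeds (subdivided_net k) \<phi>"
proof -
  define \<phi> where "\<phi> = (\<lambda>(i, j). if j = 0 then b i else q i (j - 1))"
  have \<phi>_simps: "\<phi> (i, 0) = b i" "\<phi> (i, Suc j) = q i j" for i j by (auto simp: \<phi>_def)
  have bb: "adj (b i) (b i') \<longleftrightarrow> b i \<noteq> b i'" if "i < 3" "i' < 3" for i i'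
    using assms that unfolding spider_def by blast
  have bq: "adj (b i) (q i' j) \<longleftrightarrow> j = 0 \<and> b i = b i'" "adj (q i' j) (b i) \<longleftrightarrow> j = 0 \<and> b i = b i'"
    "b i \<noteq> q i' j" "q i' j \<noteq> b i" if "i < 3" "i' < 3" "j < k" for i i' j
    using assms that adj_commute[of "b i" "q i' j"] unfolding spider_def by metis+
  have qq: "adj (q i j) (q i' j') \<longleftrightarrow> i = i' \<and> (j = Suc j' \<or> j' = Suc j)"
    "q i j = q i' j' \<longleftrightarrow> i = i' \<and> j = j'"
    if "i < 3" "i' < 3" "j < k" "j' < k" for i i' j j'
    using assms that unfolding spider_def by blast+
  have "(\<forall>i<3. b i = b 0) \<or> inj_on b {..<3}" using assms unfolding spider_def by blast
  then have "embeds (subdivided_claw k) \<phi> \<or> embeds (subdivided_net k) \<phi>"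
  proof
    assume const: "\<forall>i<3. b i = b 0"
    then have cb: "b i = b i' \<longleftrightarrow> True" if "i < 3" "i' < 3" for i i' using that by metis
    have ver: "i < 3" "j \<le> k" "j = 0 \<Longrightarrow> i = 0" if "(i, j) \<in> pverts (subdivided_claw k)" for i j
      using that by (auto simp: subdivided_claw_def)
    have eq: "\<phi> (i, j) = \<phi> (i', j') \<longleftrightarrow> (i, j) = (i', j')" and
      ad: "adj (\<phi> (i, j)) (\<phi> (i', j')) \<longleftrightarrow> ((i, j), (i', j')) \<in> parcs (subdivided_claw k)"
      if x: "(i, j) \<in> pverts (subdivided_claw k)" and y: "(i', j') \<in> pverts (subdivided_claw k)"
      for i j i' j'
      unfolding subdivided_claw_arc_iff[OF x y]
      using ver[OF x] ver[OF y] by (cases j; cases j'; simp add: \<phi>_simps bb bq qq cb)+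
    have "embeds (subdivided_claw k) \<phi>"
      unfolding embeds_def inj_on_def using eq ad by (metis surj_pair)
    then show ?thesis ..
  next
    assume inj: "inj_on b {..<3}"
    have ver: "i < 3" "j \<le> k" if "(i, j) \<in> pverts (subdivided_net k)" for i j
      using that by (auto simp: subdivided_net_def)
    have bi: "b i = b i' \<longleftrightarrow> i = i'" if "i < 3" "i' < 3" for i i'
      using inj that by (auto dest: inj_onD)
    have eq: "\<phi> (i, j) = \<phi> (i', j') \<longleftrightarrow> (i, j) = (i', j')" and
      ad: "adj (\<phi> (i, j)) (\<phi> (i', j')) \<longleftrightarrow> ((i, j), (i', j')) \<in> parcs (subdivided_net k)"
      if x: "(i, j) \<in> pverts (subdivided_net k)" and y: "(i', j') \<in> pverts (subdivided_net k)"
      for i j i' j'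
      unfolding subdivided_net_arc_iff[OF x y]
      using ver[OF x] ver[OF y] by (cases j; cases j'; simp add: \<phi>_simps bb bq qq bi; blast?)+
    have "embeds (subdivided_net k) \<phi>"
      unfolding embeds_def inj_on_def using eq ad by (metis surj_pair)
    then show ?thesis ..
  qed
  then show ?thesis by blast
qed

lemma embeds_claw_imp_spider:
  assumes "embeds (subdivided_claw k) \<phi>"
  shows "spider k (\<lambda>_. \<phi> (0, 0)) (\<lambda>i j. \<phi> (i, Suc j))"
proof -
  have ver: "(0, 0) \<in> pverts (subdivided_claw k)" "i < 3 \<Longrightarrow> j < k \<Longrightarrow> (i, Suc j) \<in> pverts (subdivided_claw k)" for i j
    by (auto simp: subdivided_claw_def)
  have eq: "\<phi> x = \<phi> y \<longleftrightarrow> x = y" and ad: "adj (\<phi> x) (\<phi> y) \<longleftrightarrow> (x, y) \<in> parcs (subdivided_claw k)"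
    if "x \<in> pverts (subdivided_claw k)" "y \<in> pverts (subdivided_claw k)" for x y
    using assms that unfolding embeds_def by (auto dest: inj_onD)
  show ?thesis
    unfolding spider_def using ver by (simp add: eq ad subdivided_claw_arc_iff)
qed

lemma embeds_net_imp_spider:
  assumes "embeds (subdivided_net k) \<phi>"
  shows "spider k (\<lambda>i. \<phi> (i, 0)) (\<lambda>i j. \<phi> (i, Suc j))"
proof -
  have ver: "i < 3 \<Longrightarrow> (i, 0) \<in> pverts (subdivided_net k)" "i < 3 \<Longrightarrow> j < k \<Longrightarrow> (i, Suc j) \<in> pverts (subdivided_net k)" for i j
    by (auto simp: subdivided_net_def)
  have eq: "\<phi> x = \<phi> y \<longleftrightarrow> x = y" and ad: "adj (\<phi> x) (\<phi> y) \<longleftrightarrow> (x, y) \<in> parcs (subdivided_net k)"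
    if "x \<in> pverts (subdivided_net k)" "y \<in> pverts (subdivided_net k)" for x y
    using assms that unfolding embeds_def by (auto dest: inj_onD)
  show ?thesis
    unfolding spider_def inj_on_def using ver by (auto simp: eq ad subdivided_net_arc_iff)
qed

text \<open>\<open>embeds\<close> mentions no vertex set, but for \<open>k \<ge> 1\<close> every
  vertex of \<open>F\<close> has a neighbour \<open>y\<close>, so its image is an end of an
  edge.\<close>

lemma embeds_image_subset:
  assumes "embeds F \<phi>" "F = subdivided_claw k \<or> F = subdivided_net k" "1 \<le> k"
    and adj_V: "\<And>x y. adj x y \<Longrightarrow> x \<in> V"
  shows "\<phi> ` pverts F \<subseteq> V"
proof -
  have "\<exists>y\<in>pverts F. (x, y) \<in> parcs F" if "x \<in> pverts F" for x
  proof -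
    obtain i j where x: "x = (i, j)" by (cases x)
    from assms(2) show ?thesis
    proof
      assume F: "F = subdivided_claw k"
      define y where "y = (if j = 0 then (0, 1) else if j = 1 then (0, 0) else (i, j - 1))"
      have "y \<in> pverts F"
        using that assms(3) by (auto simp: F x y_def subdivided_claw_def)
      moreover from this have "(x, y) \<in> parcs F"
        using that unfolding F x y_def by (auto simp: subdivided_claw_arc_iff split: if_splits)
      ultimately show ?thesis by blast
    next
      assume F: "F = subdivided_net k"
      define y where "y = (if j = 0 then (i, 1) else (i, j - 1))"
      have "y \<in> pverts F"
        using that assms(3) by (auto simp: F x y_def subdivided_net_def)
      moreover from this have "(x, y) \<in> parcs F"
        using that unfolding F x y_def by (auto simp: subdivided_net_arc_iff split: if_splits)
      ultimately show ?thesis by blast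
    qed
  qed
  then show ?thesis using assms(1) adj_V unfolding embeds_def by blast
qed

end

lemma (in sym_graph) spider_conn:
  assumes "spider k b q" and V: "V = b ` {..<3} \<union> {q i j | i j. i < 3 \<and> j < k}"
  shows "conn V"
proof (rule connI[of "b 0"])
  show "b 0 \<in> V" unfolding V by auto
  have bV: "b i \<in> V" if "i < 3" for i using that unfolding V by auto
  have qV: "q i j \<in> V" if "i < 3" "j < k" for i j using that unfolding V by auto
  have rb: "(radj V)\<^sup>*\<^sup>* (b 0) (b i)" if "i < 3" for i
  proof (cases "b i = b 0")
    case False
    have "\<forall>i<3. \<forall>i'<3. adj (b i) (b i') \<longleftrightarrow> b i \<noteq> b i'" using assms(1) unfolding spider_def by blast
    then have "adj (b 0) (b i)" using False that by fastforce
    then show ?thesis using bV[OF that] bV[of 0] by (auto simp: radj_def)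
  qed simp
  have rq: "(radj V)\<^sup>*\<^sup>* (b 0) (q i j)" if "i < 3" "j < k" for i j
    using that(2)
  proof (induction j)
    case 0
    then have "adj (b i) (q i 0)" using assms(1) that(1) unfolding spider_def by blast
    then have "radj V (b i) (q i 0)" using bV qV that 0 by (simp add: radj_def)
    with rb[OF that(1)] show ?case by (rule rtranclp.rtrancl_into_rtrancl)
  next
    case (Suc j)
    then have "adj (q i j) (q i (Suc j))" using assms(1) that(1) Suc_lessD unfolding spider_def by blast
    then have "radj V (q i j) (q i (Suc j))" using qV that Suc.prems by (simp add: radj_def)
    with Suc show ?case by (meson Suc_lessD rtranclp.rtrancl_into_rtrancl)
  qed
  show "(radj V)\<^sup>*\<^sup>* (b 0) y" if "y \<in> V" for y
    using that rb rq unfolding V by blast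
qed

section \<open>Path eccentricity of digraphs\<close>

lemma graph_induced_subgraph:
  assumes "graph G" "induced_subgraph H G"
  shows "graph H"
proof -
  interpret graph G by fact
  interpret H: digraph H using assms(2) by (rule digraphI_induced)
  interpret H: sym_digraph H using assms(2) by (rule induced_graph_imp_graph)
  show ?thesis by unfold_locales
qed

lemma arcs_ends_induced_subgraph:
  assumes "induced_subgraph H G"
  shows "x \<rightarrow>\<^bsub>H\<^esub> y \<longleftrightarrow> x \<rightarrow>\<^bsub>G\<^esub> y \<and> x \<in> verts H \<and> y \<in> verts H"
proof -
  have "compatible G H" using assms by auto
  then show ?thesis
    using assms unfolding induced_subgraph_def arcs_ends_conv
    by (auto simp: compatible_tail compatible_head)
qed

lemma arcs_ends_verts: "graph H \<Longrightarrow> x \<rightarrow>\<^bsub>H\<^esub> y \<Longrightarrow> x \<in> verts H \<and> y \<in> verts H"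
  by (meson graph.axioms(1) digraph.axioms(1) fin_digraph.axioms(1) wf_digraph.adj_in_verts)

lemma sym_graph_dominates:
  assumes "graph H" shows "sym_graph (dominates H)"
proof -
  interpret graph H by fact
  show ?thesis
  proof
    show "x \<rightarrow>\<^bsub>H\<^esub> y \<longleftrightarrow> y \<rightarrow>\<^bsub>H\<^esub> x" for x y using graph_symmetric by blast
    show "\<not> x \<rightarrow>\<^bsub>H\<^esub> x" for x using adj_not_same by blast
  qed
qed

lemma digraph_iso_with_projI:
  assumes "graph H" "inj_on g (verts H)" "g ` verts H = pverts F" "parcs F \<subseteq> pverts F \<times> pverts F"
    and arc: "\<And>x y. x \<in> verts H \<Longrightarrow> y \<in> verts H \<Longrightarrow> x \<rightarrow>\<^bsub>H\<^esub> y \<longleftrightarrow> (g x, g y) \<in> parcs F"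
  shows "digraph_iso H (with_proj F)"
proof -
  interpret graph H by fact
  \<comment> \<open>The arcs of \<open>with_proj F\<close> are pairs of vertices, so an arc goes to
    the pair of images of its ends; this is injective since \<open>H\<close> has no parallel
    arcs.\<close>
  define f where "f = \<lparr>iso_verts = g, iso_arcs = (\<lambda>e. (g (tail H e), g (head H e))),
    iso_head = snd, iso_tail = fst\<rparr>"
  have "inj_on (iso_arcs f) (arcs H)"
  proof (rule inj_onI)
    fix e e' assume e: "e \<in> arcs H" "e' \<in> arcs H" "iso_arcs f e = iso_arcs f e'"
    then have "tail H e = tail H e'" "head H e = head H e'"
      using inj_on_eq_iff[OF assms(2)] by (auto simp: f_def)
    then show "e = e'" using no_multi_arcs[OF e(1,2)] by (simp add: arc_to_ends_def)
  qed
  then have "digraph_isomorphism f"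
    unfolding digraph_isomorphism_def using wf_digraph assms(2) by (simp add: f_def)
  moreover have "(\<lambda>e. (g (tail H e), g (head H e))) ` arcs H = parcs F"
  proof (intro equalityI subsetI)
    fix z assume "z \<in> (\<lambda>e. (g (tail H e), g (head H e))) ` arcs H"
    then obtain e where e: "e \<in> arcs H" "z = (g (tail H e), g (head H e))" by auto
    then show "z \<in> parcs F" using arc[of "tail H e" "head H e"] by (auto simp: arcs_ends_conv)
  next
    fix z assume z: "z \<in> parcs F"
    then have "z \<in> g ` verts H \<times> g ` verts H" using assms(3,4) by auto
    then obtain x y where xy: "x \<in> verts H" "y \<in> verts H" "z = (g x, g y)" by auto
    then obtain e where "e \<in> arcs H" "tail H e = x" "head H e = y"
      using arc[OF xy(1,2)] z by auto
    then show "z \<in> (\<lambda>e. (g (tail H e), g (head H e))) ` arcs H" using xy by auto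
  qed
  then have "with_proj F = app_iso f H"
    using assms(3) by (simp add: app_iso_def f_def with_proj_def)
  ultimately show ?thesis unfolding digraph_iso_def by blast
qed

lemma digraph_iso_with_projE:
  assumes "digraph_iso H (with_proj F)"
  obtains g where "inj_on g (verts H)" "g ` verts H = pverts F"
    "\<And>x y. x \<in> verts H \<Longrightarrow> y \<in> verts H \<Longrightarrow> x \<rightarrow>\<^bsub>H\<^esub> y \<longleftrightarrow> (g x, g y) \<in> parcs F"
proof -
  obtain f where f: "pre_digraph.digraph_isomorphism H f" "with_proj F = app_iso f H"
    using assms unfolding digraph_iso_def by blast
  define g where "g = iso_verts f"
  have wf: "wf_digraph H" and inj: "inj_on g (verts H)"
    and ends: "\<And>e. e \<in> arcs H \<Longrightarrow> g (tail H e) = iso_tail f (iso_arcs f e) \<and> g (head H e) = iso_head f (iso_arcs f e)"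
    using f(1) unfolding pre_digraph.digraph_isomorphism_def g_def by auto
  have F: "pverts F = g ` verts H" "parcs F = iso_arcs f ` arcs H" "iso_tail f = fst" "iso_head f = snd"
    using f(2) unfolding with_proj_def app_iso_def g_def by auto
  have par: "parcs F = (\<lambda>e. (g (tail H e), g (head H e))) ` arcs H"
    unfolding F(2) by (rule image_cong) (auto simp: ends F(3,4))
  have "x \<rightarrow>\<^bsub>H\<^esub> y \<longleftrightarrow> (g x, g y) \<in> parcs F" if "x \<in> verts H" "y \<in> verts H" for x y
  proof
    assume "(g x, g y) \<in> parcs F"
    then obtain e where e: "e \<in> arcs H" "g x = g (tail H e)" "g y = g (head H e)"
      unfolding par by auto
    then have "x = tail H e" "y = head H e"
      using inj that wf_digraph.tail_in_verts[OF wf e(1)] wf_digraph.head_in_verts[OF wf e(1)]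
      by (auto dest: inj_onD)
    then show "x \<rightarrow>\<^bsub>H\<^esub> y" using e(1) by (auto simp: arcs_ends_conv)
  qed (auto simp: par arcs_ends_conv)
  then show thesis using that inj F(1) by blast
qed

section \<open>Distance and eccentricity through relation powers\<close>

lemma vwalk_iff_successively:
  "vwalk p H \<longleftrightarrow> p \<noteq> [] \<and> set p \<subseteq> verts H \<and> successively (dominates H) p"
proof -
  have "set (vwalk_arcs p) \<subseteq> arcs_ends H \<longleftrightarrow> successively (dominates H) p"
    by (induction p rule: vwalk_arcs.induct) auto
  then show ?thesis by (auto simp: vwalk_def)
qed

lemma successively_relpowp:
  "successively P p \<Longrightarrow> p \<noteq> [] \<Longrightarrow> (P ^^ (length p - 1)) (hd p) (last p)"
proof (induction p)
  case (Cons x p)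
  then show ?case by (cases p) (auto intro!: relpowp_Suc_I2 simp del: relpowp.simps(2))
qed simp

lemma vwalk_iff_relpowp:
  assumes "graph H" "u \<in> verts H"
  shows "(\<exists>p. vwalk p H \<and> hd p = u \<and> last p = v \<and> vwalk_length p = n) \<longleftrightarrow> (dominates H ^^ n) u v"
proof
  assume "\<exists>p. vwalk p H \<and> hd p = u \<and> last p = v \<and> vwalk_length p = n"
  then show "(dominates H ^^ n) u v"
    using successively_relpowp by (auto simp: vwalk_iff_successively)
next
  assume "(dominates H ^^ n) u v"
  then obtain f where f: "f 0 = u" "f n = v" "\<And>i. i < n \<Longrightarrow> f i \<rightarrow>\<^bsub>H\<^esub> f (Suc i)"
    unfolding relpowp_fun_conv by blast
  have "f i \<in> verts H" if "i \<le> n" for i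
    using that f(1) assms arcs_ends_verts[OF assms(1) f(3)[of "i - 1"]] by (cases i) auto
  then have "vwalk (map f [0..<Suc n]) H"
    unfolding vwalk_iff_successively successively_conv_nth using f(3) by (auto simp del: upt_Suc)
  moreover have "hd (map f [0..<Suc n]) = u" "last (map f [0..<Suc n]) = v"
    using f by (auto simp: hd_map last_map simp del: upt_Suc)
  ultimately show "\<exists>p. vwalk p H \<and> hd p = u \<and> last p = v \<and> vwalk_length p = n"
    by (intro exI[of _ "map f [0..<Suc n]"]) auto
qed

lemma connected_iff_conn:
  assumes "graph H"
  shows "Digraph_Component.connected H \<longleftrightarrow> sym_graph.conn (dominates H) (verts H)"
proof -
  interpret graph H by fact
  interpret S: sym_graph "dominates H" using assms by (rule sym_graph_dominates)
  have sym: "(arcs_ends H)\<^sup>s = arcs_ends H"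
    using graph_symmetric by (auto simp: symcl_def)
  have "(u, v) \<in> rtrancl_on (verts H) (arcs_ends H) \<longleftrightarrow> (S.radj (verts H))\<^sup>*\<^sup>* u v"
    if "u \<in> verts H" for u v
  proof
    assume "(u, v) \<in> rtrancl_on (verts H) (arcs_ends H)"
    then show "(S.radj (verts H))\<^sup>*\<^sup>* u v"
    proof (induction rule: rtrancl_on_induct)
      case (step x y)
      then have "S.radj (verts H) x y" by (auto simp: S.radj_def)
      with step.IH show ?case by (rule rtranclp.rtrancl_into_rtrancl)
    qed simp
  next
    assume "(S.radj (verts H))\<^sup>*\<^sup>* u v"
    then show "(u, v) \<in> rtrancl_on (verts H) (arcs_ends H)"
    proof (induction rule: rtranclp_induct)
      case base
      then show ?case using that by (rule rtrancl_on_refl)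
    next
      case (step x y)
      then show ?case by (auto simp: S.radj_def intro: rtrancl_on_into_rtrancl_on)
    qed
  qed
  then show ?thesis unfolding connected_conv sym S.conn_def by blast
qed

text \<open>Connectedness provides some walk, so the \<open>LEAST\<close> in
  \<open>graph_dist\<close> is attained.\<close>

lemma graph_dist_less_iff:
  assumes "graph H" "Digraph_Component.connected H" "u \<in> verts H" "v \<in> verts H"
  shows "graph_dist H u v < k \<longleftrightarrow> sym_graph.near (dominates H) k u v"
proof -
  interpret S: sym_graph "dominates H" using assms(1) by (rule sym_graph_dominates)
  have "S.conn (verts H)" using assms(1,2) by (simp add: connected_iff_conn)
  then obtain n where "(dominates H ^^ n) u v"
    using S.rdist_walk[OF _ assms(3,4)] S.radj_pow_adj by blast
  then have "(dominates H ^^ (LEAST n. (dominates H ^^ n) u v)) u v" by (rule LeastI)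
  then show ?thesis
    unfolding graph_dist_def vwalk_iff_relpowp[OF assms(1,3)] S.near_def
    by (metis (no_types, lifting) Least_le le_less_trans)
qed

text \<open>The bounds on \<open>Min\<close> and \<open>Max\<close> unfold because all sets involved
  are finite and nonempty: paths are distinct lists over a finite set, and a single vertex is
  one.\<close>

lemma path_eccentricity_less_iff:
  assumes "graph H" "Digraph_Component.connected H"
  shows "path_eccentricity H < k \<longleftrightarrow>
    (\<exists>p. vpath p H \<and> (\<forall>v\<in>verts H. \<exists>u\<in>set p. sym_graph.near (dominates H) k v u))"
proof -
  interpret graph H by fact
  have ne: "verts H \<noteq> {}" using assms(2) by (auto simp: connected_conv)
  then obtain w where "w \<in> verts H" by blast
  then have "vpath [w] H" by (auto simp: vpath_def vwalk_iff_successively)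
  moreover have "{p. vpath p H} \<subseteq> {p. set p \<subseteq> verts H \<and> distinct p}"
    by (auto simp: vpath_def vwalk_iff_successively)
  then have "finite {p. vpath p H}"
    by (rule finite_subset) (rule finite_subset_distinct[OF finite_verts])
  ultimately have "path_eccentricity H < k \<longleftrightarrow> (\<exists>p. vpath p H \<and> path_ecc H p < k)"
    unfolding path_eccentricity_def by (subst Min_less_iff) auto
  moreover have "path_ecc H p < k \<longleftrightarrow> (\<forall>v\<in>verts H. \<exists>u\<in>set p. sym_graph.near (dominates H) k v u)"
    if p: "vpath p H" for p
  proof -
    have sub: "set p \<subseteq> verts H" "p \<noteq> []" using p by (auto simp: vpath_def vwalk_iff_successively)
    have "path_ecc H p < k \<longleftrightarrow> (\<forall>v\<in>verts H. dist_to_set H v (set p) < k)"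
      unfolding path_ecc_def using ne by (subst Max_less_iff) auto
    also have "\<dots> \<longleftrightarrow> (\<forall>v\<in>verts H. \<exists>u\<in>set p. graph_dist H v u < k)"
      unfolding dist_to_set_def using sub by (subst Min_less_iff) auto
    also have "\<dots> \<longleftrightarrow> (\<forall>v\<in>verts H. \<exists>u\<in>set p. sym_graph.near (dominates H) k v u)"
      using graph_dist_less_iff[OF assms] sub by blast
    finally show ?thesis .
  qed
  ultimately show ?thesis by blast
qed

section \<open>The two directions of the equivalence\<close>

lemma spider_imp_not_induced_free:
  assumes "graph G" "induced_subgraph H G" "1 \<le> k" "sym_graph.spider (dominates H) k b q"
  shows "\<not> induced_free {with_proj (subdivided_claw k), with_proj (subdivided_net k)} G"
proof -
  interpret graph G by fact
  have H: "graph H" using assms(1,2) by (rule graph_induced_subgraph)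
  interpret S: sym_graph "dominates H" using H by (rule sym_graph_dominates)
  obtain F \<phi> where F: "F = subdivided_claw k \<or> F = subdivided_net k" and \<phi>: "S.embeds F \<phi>"
    using S.spider_imp_embeds[OF assms(4)] by blast
  define W where "W = \<phi> ` pverts F"
  have WH: "W \<subseteq> verts H"
    unfolding W_def by (rule S.embeds_image_subset[OF \<phi> F assms(3)]) (use arcs_ends_verts[OF H] in blast)
  then have WG: "W \<subseteq> verts G" using assms(2) by auto
  \<comment> \<open>The copy is found in \<open>H\<close> but induced in \<open>G\<close>; the arcs
    agree because \<open>H\<close> is itself induced.\<close>
  have ind: "induced_subgraph (G \<restriction> W) G" using WG by (rule induced_induce)
  have inj: "inj_on \<phi> (pverts F)" using \<phi> by (simp add: S.embeds_def)
  define g where "g = the_inv_into (pverts F) \<phi>"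
  have g: "g (\<phi> x) = x" if "x \<in> pverts F" for x
    using that inj by (simp add: g_def the_inv_into_f_f)
  have "parcs F \<subseteq> pverts F \<times> pverts F"
    using F arcs_ends_verts[OF graph_subdivided_claw, of _ _ k] arcs_ends_verts[OF graph_subdivided_net, of _ _ k]
    by auto
  moreover have "inj_on g (verts (G \<restriction> W))"
    by (rule inj_onI) (auto simp: W_def g)
  moreover have "g ` verts (G \<restriction> W) = pverts F"
    by (auto simp: W_def g image_image)
  moreover have "x \<rightarrow>\<^bsub>G \<restriction> W\<^esub> y \<longleftrightarrow> (g x, g y) \<in> parcs F"
    if vxy: "x \<in> verts (G \<restriction> W)" "y \<in> verts (G \<restriction> W)" for x y
  proof -
    obtain s t where st: "s \<in> pverts F" "t \<in> pverts F" "x = \<phi> s" "y = \<phi> t"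
      using vxy by (auto simp: W_def simp del: split_paired_Ex)
    have xy: "x \<in> W" "y \<in> W" using vxy by auto
    have "x \<rightarrow>\<^bsub>G \<restriction> W\<^esub> y \<longleftrightarrow> x \<rightarrow>\<^bsub>H\<^esub> y"
      using xy WH arcs_ends_induced_subgraph[OF ind, of x y] arcs_ends_induced_subgraph[OF assms(2), of x y]
      by auto
    then show ?thesis using \<phi> st g by (simp add: S.embeds_def)
  qed
  ultimately have "digraph_iso (G \<restriction> W) (with_proj F)"
    using graph_induced_subgraph[OF assms(1) ind] by (intro digraph_iso_with_projI)
  then show ?thesis using ind F unfolding induced_free_def by blast
qed

lemma path_eccentricity_of_spider:
  assumes "graph H" "1 \<le> k" "sym_graph.spider (dominates H) k b q"
    and V: "verts H = b ` {..<3} \<union> {q i j | i j. i < 3 \<and> j < k}"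
  shows "Digraph_Component.connected H" "\<not> path_eccentricity H < k"
proof -
  interpret S: sym_graph "dominates H" using assms(1) by (rule sym_graph_dominates)
  show con: "Digraph_Component.connected H"
    using S.spider_conn[OF assms(3) V] assms(1) by (simp add: connected_iff_conn)
  show "\<not> path_eccentricity H < k"
  proof
    assume "path_eccentricity H < k"
    then obtain p where p: "vpath p H" "\<And>v. v \<in> verts H \<Longrightarrow> \<exists>u\<in>set p. S.near k v u"
      using path_eccentricity_less_iff[OF assms(1) con] by blast
    obtain v where "v \<in> verts H" "\<And>u. u \<in> set p \<Longrightarrow> \<not> S.near k u v"
      using S.spider_no_covering_path[OF assms(3,2) V, of p] p(1) arcs_ends_verts[OF assms(1)]
      by (auto simp: vpath_def vwalk_iff_successively)
    then show False using p(2) S.near_sym by blast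
  qed
qed

text \<open>The inverse of the isomorphism embeds \<open>F\<close> as a spider that fills
  \<open>H\<close>.\<close>

lemma path_eccentricity_of_subdivided:
  assumes "graph H" "1 \<le> k" "F = subdivided_claw k \<or> F = subdivided_net k"
    and "digraph_iso H (with_proj F)"
  shows "Digraph_Component.connected H" "\<not> path_eccentricity H < k"
proof -
  interpret S: sym_graph "dominates H" using assms(1) by (rule sym_graph_dominates)
  obtain g where g: "inj_on g (verts H)" "g ` verts H = pverts F"
    "\<And>x y. x \<in> verts H \<Longrightarrow> y \<in> verts H \<Longrightarrow> x \<rightarrow>\<^bsub>H\<^esub> y \<longleftrightarrow> (g x, g y) \<in> parcs F"
    using digraph_iso_with_projE[OF assms(4)] by metis
  define \<phi> where "\<phi> = the_inv_into (verts H) g"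
  have \<phi>: "\<phi> x \<in> verts H" "g (\<phi> x) = x" if "x \<in> pverts F" for x
    using that g(1,2) the_inv_into_into[OF g(1), of x] f_the_inv_into_f[OF g(1), of x]
    by (auto simp: \<phi>_def)
  have emb: "S.embeds F \<phi>"
    unfolding S.embeds_def inj_on_def using \<phi> g(3) by metis
  have V: "verts H = \<phi> ` pverts F"
    unfolding \<phi>_def g(2)[symmetric] using g(1) by (simp add: the_inv_into_onto)
  have img: "\<phi> ` {(i, Suc j) | i j. i < 3 \<and> j < k} = {\<phi> (i, Suc j) | i j. i < 3 \<and> j < k}" by blast
  have "\<exists>b q. S.spider k b q \<and> verts H = b ` {..<3} \<union> {q i j | i j. i < 3 \<and> j < k}"
    using assms(3)
  proof
    assume F: "F = subdivided_claw k"
    have P: "pverts F = insert (0, 0) {(i, Suc j) | i j. i < 3 \<and> j < k}"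
      unfolding F subdivided_claw_def by (auto simp: Suc_le_eq gr0_conv_Suc)
    have "verts H = (\<lambda>_. \<phi> (0, 0)) ` {..<3::nat} \<union> {\<phi> (i, Suc j) | i j. i < 3 \<and> j < k}"
      unfolding V P image_insert img by (simp add: image_constant_conv lessThan_empty_iff)
    then show ?thesis using S.embeds_claw_imp_spider[OF emb[unfolded F]]
      by (intro exI[of _ "\<lambda>_. \<phi> (0, 0)"] exI[of _ "\<lambda>i j. \<phi> (i, Suc j)"] conjI)
  next
    assume F: "F = subdivided_net k"
    have P: "pverts F = (\<lambda>i. (i, 0)) ` {..<3} \<union> {(i, Suc j) | i j. i < 3 \<and> j < k}"
      unfolding F subdivided_net_def by (auto simp: image_iff less_Suc_eq_0_disj Suc_le_eq gr0_conv_Suc)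
    have "verts H = (\<lambda>i. \<phi> (i, 0)) ` {..<3} \<union> {\<phi> (i, Suc j) | i j. i < 3 \<and> j < k}"
      unfolding V P image_Un image_image img ..
    then show ?thesis using S.embeds_net_imp_spider[OF emb[unfolded F]]
      by (intro exI[of _ "\<lambda>i. \<phi> (i, 0)"] exI[of _ "\<lambda>i j. \<phi> (i, Suc j)"] conjI)
  qed
  then obtain b q where "S.spider k b q" "verts H = b ` {..<3} \<union> {q i j | i j. i < 3 \<and> j < k}" by blast
  from path_eccentricity_of_spider[OF assms(1,2) this]
  show "Digraph_Component.connected H" "\<not> path_eccentricity H < k" .
qed

lemma path_eccentricity_less_of_spider_free:
  assumes "graph H" "Digraph_Component.connected H" "1 \<le> k"
    and "\<nexists>b q. sym_graph.spider (dominates H) k b q"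
  shows "path_eccentricity H < k"
proof -
  interpret graph H by fact
  interpret S: sym_graph "dominates H" using assms(1) by (rule sym_graph_dominates)
  interpret C: distance_cover "dominates H" "verts H" k
    by unfold_locales (use assms connected_iff_conn arcs_ends_verts[OF assms(1)] in auto)
  obtain D where D: "S.traceable D" "D \<noteq> {}" "D \<subseteq> verts H" "C.covers D"
    using C.traceable_cover[OF assms(4)] by blast
  then obtain p where p: "distinct p" "set p = D" "successively (dominates H) p"
    by (auto simp: S.traceable_def)
  then have "vpath p H" using D by (auto simp: vpath_def vwalk_iff_successively)
  moreover have "\<forall>v\<in>verts H. \<exists>u\<in>set p. S.near k v u"
    using D(4) p(2) S.near_sym unfolding C.covers_def by blast
  ultimately show ?thesis using path_eccentricity_less_iff[OF assms(1,2)] by blast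
qed

theorem theorem4:
  fixes k :: nat and G :: "('a,'b) pre_digraph"
  assumes "k \<ge> 1" and "graph G"
  shows "(\<forall>H. induced_subgraph H G \<and> Digraph_Component.connected H
              \<longrightarrow> path_eccentricity H < k)
     \<longleftrightarrow> induced_free {with_proj (subdivided_claw k), with_proj (subdivided_net k)} G"
proof
  assume pe: "\<forall>H. induced_subgraph H G \<and> Digraph_Component.connected H \<longrightarrow> path_eccentricity H < k"
  \<comment> \<open>An induced copy of the claw or net is itself a connected induced subgraph
    violating the bound.\<close>
  have False
    if "induced_subgraph H G" "F = subdivided_claw k \<or> F = subdivided_net k"
      "digraph_iso H (with_proj F)" for H :: "('a,'b) pre_digraph" and F
    using path_eccentricity_of_subdivided[OF graph_induced_subgraph[OF assms(2) that(1)] assms(1) that(2,3)]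
      pe that(1) by blast
  then show "induced_free {with_proj (subdivided_claw k), with_proj (subdivided_net k)} G"
    unfolding induced_free_def by blast
next
  assume free: "induced_free {with_proj (subdivided_claw k), with_proj (subdivided_net k)} G"
  show "\<forall>H. induced_subgraph H G \<and> Digraph_Component.connected H \<longrightarrow> path_eccentricity H < k"
    using path_eccentricity_less_of_spider_free graph_induced_subgraph[OF assms(2)]
      spider_imp_not_induced_free[OF assms(2) _ assms(1)] free assms(1) by blast
qed

end
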